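(* Let $n\ge3$. An even smooth function $\varphi$ on $\mathbb{S}^{n-1}\times\mathbb{R}$ can be reconstructed from its dual Radon transform $f(\omega,u)=(R^*\varphi)(\omega,u)$ by the formula $$\varphi(\theta,t)=\bigl(F^{-1}[f(\cdot,\mathrm{Pr}_{(\cdot)^\perp}x)]\bigr)(\theta)\Big|_{x=t\theta},\qquad (\theta,t)\in\mathbb{S}^{n-1}\times\mathbb{R};$$ that is, for each fixed $x\in\mathbb{R}^n$ the inverse Funk transform $F^{-1}$ is applied to the function $\omega\mapsto f(\omega,\mathrm{Pr}_{\omega^\perp}x)$ on $\mathbb{S}^{n-1}$, the result is evaluated at $\theta$, and then one sets $x=t\theta$.
   Context: A function $\varphi$ on $\mathbb{S}^{n-1}\times\mathbb{R}$ is even if $\varphi(\theta,t)=\varphi(-\theta,-t)$; such functions are identified with functions on the set of hyperplanes $\{x:x\cdot\theta=t\}$ in $\mathbb{R}^n$. The dual Radon transform from hyperplanes to lines is $$(R^*\varphi)(\omega,u)=\int_{\mathbb{S}^{n-1}\cap\omega^\perp}\varphi(\theta,\theta\cdot u)\,d_\omega\theta,\qquad \omega\in\mathbb{S}^{n-1},\ u\in\omega^\perp,$$ where $d_\omega\theta$ is the probability measure on $\mathbb{S}^{n-1}\cap\omega^\perp$ invariant under orthogonal transformations fixing $\omega$. $\mathrm{Pr}_{\omega^\perp}$ is the orthogonal projection onto $\omega^\perp$. $F^{-1}$ is the inverse, on smooth even functions on $\mathbb{S}^{n-1}$, of the Funk transform $(F\psi)(\omega)=\int_{\mathbb{S}^{n-1}\cap\omega^\perp}\psi(\theta)\,d_\omega\theta$.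 *)

theory Defs
  imports "HOL-Probability.Probability"
begin

text \<open>\<open>C\<^sup>k\<close> functions on an open set: all iterated directional derivatives up to order \<open>k\<close>
  exist as Frechet derivatives and are continuous.\<close>

primrec C_k_on :: "nat \<Rightarrow> 'a::euclidean_space set \<Rightarrow> ('a \<Rightarrow> 'b::real_normed_vector) \<Rightarrow> bool" where
  "C_k_on 0 U f \<longleftrightarrow> continuous_on U f"
| "C_k_on (Suc k) U f \<longleftrightarrow> (\<forall>x\<in>U. f differentiable (at x)) \<and>
     (\<forall>v. C_k_on k U (\<lambda>x. frechet_derivative f (at x) v))"

text \<open>Smoothness on a subset \<open>M\<close> of a Euclidean space, intended for embedded submanifolds: near each
  point of \<open>M\<close> the function extends to a \<open>C\<^sup>\<infinity>\<close> function on an open subset of the ambient space.\<close>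

definition smooth_on_sub :: "'a::euclidean_space set \<Rightarrow> ('a \<Rightarrow> 'b::real_normed_vector) \<Rightarrow> bool" where
  "smooth_on_sub M f \<longleftrightarrow> (\<forall>p\<in>M. \<exists>U g. open U \<and> p \<in> U \<and> (\<forall>k. C_k_on k U g) \<and>
     (\<forall>x\<in>U \<inter> M. g x = f x))"

abbreviation unit_sphere :: "'a::euclidean_space set" where
  "unit_sphere \<equiv> sphere 0 1"

definition perp :: "'a::euclidean_space \<Rightarrow> 'a set" where
  "perp \<omega> = {u. u \<bullet> \<omega> = 0}"

definition proj_perp :: "'a::euclidean_space \<Rightarrow> 'a \<Rightarrow> 'a" where
  "proj_perp \<omega> x = x - ((x \<bullet> \<omega>) / (\<omega> \<bullet> \<omega>)) *\<^sub>R \<omega>"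

text \<open>\<open>proj_perp \<omega>\<close> is the orthogonal projection onto \<open>perp \<omega>\<close>.\<close>

lemma proj_perp_in_perp: "proj_perp \<omega> x \<in> perp \<omega>"
  by (cases "\<omega> = 0") (simp_all add: proj_perp_def perp_def inner_diff_left)

lemma proj_perp_orthogonal: "y \<in> perp \<omega> \<Longrightarrow> (x - proj_perp \<omega> x) \<bullet> y = 0"
  by (simp add: proj_perp_def perp_def inner_commute)

text \<open>The Borel probability measure on the great subsphere orthogonal to \<open>\<omega>\<close> that is invariant under
  the orthogonal transformations fixing \<open>\<omega>\<close>. These act transitively on the subsphere when
  \<open>norm \<omega> = 1\<close> and the dimension is at least 2, so the measure is unique.\<close>

definition subsphere_measure :: "'a::euclidean_space \<Rightarrow> 'a measure" where
  "subsphere_measure \<omega> = (THE \<mu>.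
     sets \<mu> = sets (restrict_space borel (unit_sphere \<inter> perp \<omega>)) \<and>
     prob_space \<mu> \<and>
     (\<forall>T. orthogonal_transformation T \<and> T \<omega> = \<omega> \<longrightarrow> distr \<mu> \<mu> T = \<mu>))"

text \<open>Only the values at \<open>\<omega> \<in> unit_sphere\<close>, \<open>u \<in> perp \<omega>\<close> are meaningful.\<close>

definition dual_Radon ::
    "('a::euclidean_space \<times> real \<Rightarrow> complex) \<Rightarrow> 'a \<Rightarrow> 'a \<Rightarrow> complex" where
  "dual_Radon \<phi> \<omega> u = (LINT \<theta>|subsphere_measure \<omega>. \<phi> (\<theta>, \<theta> \<bullet> u))"

text \<open>Functions on the sphere are represented extensionally (arbitrary but fixed value outside), so
  that equality of functions is equality on the sphere.\<close>

definition even_smooth_sphere :: "('a::euclidean_space \<Rightarrow> complex) set" where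
  "even_smooth_sphere = {\<psi> \<in> extensional unit_sphere.
     smooth_on_sub unit_sphere \<psi> \<and> (\<forall>\<theta>\<in>unit_sphere. \<psi> (- \<theta>) = \<psi> \<theta>)}"

definition Funk :: "('a::euclidean_space \<Rightarrow> complex) \<Rightarrow> ('a \<Rightarrow> complex)" where
  "Funk \<psi> = (\<lambda>\<omega>\<in>unit_sphere. LINT \<theta>|subsphere_measure \<omega>. \<psi> \<theta>)"

definition Funk_inv :: "('a::euclidean_space \<Rightarrow> complex) \<Rightarrow> ('a \<Rightarrow> complex)" where
  "Funk_inv = the_inv_into even_smooth_sphere Funk"

end

theory Submission
  imports Defs
begin

text \<open>
  For \<open>\<theta>\<close> orthogonal to \<open>\<omega>\<close> one has \<open>\<theta> \<bullet> proj_perp \<omega> x = \<theta> \<bullet> x\<close>, so \<open>\<omega> \<mapsto> f \<omega> (proj_perp \<omega> x)\<close>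
  is the Funk transform of the even smooth function \<open>\<theta> \<mapsto> \<phi> (\<theta>, \<theta> \<bullet> x)\<close>, and everything rests on
  injectivity of the Funk transform \<open>F\<close>.

  \<open>F\<close> is self-adjoint, because the invariant probability measure on orthonormal pairs is unique and
  hence symmetric. By invariance \<open>F\<close> maps \<open>(\<theta> \<bullet> e) ^ (2 * k)\<close> to a positive multiple of
  \<open>(1 - (\<omega> \<bullet> e)\<^sup>2) ^ k\<close>. So if \<open>F \<psi> = 0\<close>, then \<open>\<psi>\<close> is orthogonal to all these powers, and by the
  binomial theorem to all \<open>(\<theta> \<bullet> e) ^ (2 * k)\<close>. These concentrate at \<open>e\<close> and \<open>- e\<close> as \<open>k\<close> grows,
  which forces \<open>\<psi> e = 0\<close> for even continuous \<open>\<psi>\<close>.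
\<close>

subsection \<open>Measures with the same uniform ball masses\<close>

text \<open>Every closed set is the countable union of its intersections with closed balls of
  integer radius, which are compact by Heine-Borel. This makes the compact sets an
  intersection-stable generator on which measures can be compared.\<close>

lemma borel_eq_compact: "(borel :: 'a::heine_borel measure) = sigma UNIV (Collect compact)"
proof (rule borel_eq_sigmaI1[OF borel_eq_closed, where F = "\<lambda>x. x" and A = "Collect compact", simplified image_ident])
  fix X :: "'a set" assume "X \<in> Collect closed"
  then have "closed X" by simp
  obtain a :: 'a where True by simp
  have "compact (X \<inter> cball a (real n))" for n
    using \<open>closed X\<close> by (simp add: closed_Int_compact)
  then have "(\<Union>n. X \<inter> cball a (real n)) \<in> sets (sigma UNIV (Collect compact))"
    by (intro sets.countable_UN) (auto intro: sigma_sets.Basic)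
  moreover have "(\<Union>n. X \<inter> cball a (real n)) = X"
    using real_arch_simple by (auto simp: mem_cball)
  ultimately show "X \<in> sets (sigma UNIV (Collect compact))" by simp
qed (auto intro: borel_compact)

lemma borel_dist_less:
  "{p :: 'a::{metric_space, second_countable_topology} \<times> 'a. dist (fst p) (snd p) < e}
    \<in> sets (borel \<Otimes>\<^sub>M borel)"
  unfolding borel_prod by (intro borel_open open_Collect_less continuous_intros)

text \<open>Count the pairs \<open>(x, y)\<close> with \<open>x \<in> A\<close> and \<open>dist x y < e\<close> in both orders of integration.\<close>

lemma uniform_balls_le_nhd:
  fixes \<mu> \<nu> :: "'a::{metric_space, second_countable_topology} measure"
  assumes sets [measurable_cong]: "sets \<mu> = sets borel" "sets \<nu> = sets borel"
    and fin: "sigma_finite_measure \<mu>" "sigma_finite_measure \<nu>"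
    and conc: "AE x in \<mu>. x \<in> M" "AE x in \<nu>. x \<in> M"
    and c: "c > 0" "c < \<infinity>"
    and balls: "\<And>y. y \<in> M \<Longrightarrow> emeasure \<mu> (ball y e) = c" "\<And>y. y \<in> M \<Longrightarrow> emeasure \<nu> (ball y e) = c"
    and A: "A \<in> sets borel"
  shows "emeasure \<mu> A \<le> emeasure \<nu> (\<Union>x\<in>A. ball x e)"
proof -
  interpret M: sigma_finite_measure \<mu> by fact
  interpret N: sigma_finite_measure \<nu> by fact
  interpret P: pair_sigma_finite \<mu> \<nu> ..
  define U where "U = (\<Union>x\<in>A. ball x e)"
  have "open U" unfolding U_def by auto
  then have U [measurable]: "U \<in> sets borel" by simp
  note A [measurable]
  have m: "(\<lambda>(x, y). indicator A x * indicator {p. dist (fst p) (snd p) < e} (x, y) :: ennreal)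
      \<in> borel_measurable (\<mu> \<Otimes>\<^sub>M \<nu>)"
  proof -
    note [measurable] = borel_dist_less[where e = e]
    have "(\<lambda>p. indicator A (fst p) * indicator {p. dist (fst p) (snd p) < e} p :: ennreal)
      \<in> borel_measurable (borel \<Otimes>\<^sub>M borel)" by measurable
    then show ?thesis
      by (simp add: split_beta' measurable_cong_sets[OF sets_pair_measure_cong[OF sets] refl])
  qed
  have "c * emeasure \<mu> A = (\<integral>\<^sup>+x. c * indicator A x \<partial>\<mu>)"
    using A sets by (simp add: nn_integral_cmult_indicator)
  also have "\<dots> = (\<integral>\<^sup>+x. (\<integral>\<^sup>+y. indicator A x * indicator {p. dist (fst p) (snd p) < e} (x, y) \<partial>\<nu>) \<partial>\<mu>)"
  proof (rule nn_integral_cong_AE, use conc(1) in eventually_elim)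
    fix x assume "x \<in> M"
    have "(\<integral>\<^sup>+y. indicator A x * indicator {p. dist (fst p) (snd p) < e} (x, y) \<partial>\<nu>)
      = (\<integral>\<^sup>+y. indicator A x * indicator (ball x e) y \<partial>\<nu>)"
      by (intro nn_integral_cong) (auto split: split_indicator)
    also have "\<dots> = indicator A x * c"
      using sets balls(2)[OF \<open>x \<in> M\<close>] by (subst nn_integral_cmult_indicator) auto
    finally show "c * indicator A x = (\<integral>\<^sup>+y. indicator A x * indicator {p. dist (fst p) (snd p) < e} (x, y) \<partial>\<nu>)"
      by (simp add: mult.commute)
  qed
  also have "\<dots> = (\<integral>\<^sup>+y. (\<integral>\<^sup>+x. indicator A x * indicator {p. dist (fst p) (snd p) < e} (x, y) \<partial>\<mu>) \<partial>\<nu>)"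
    using P.Fubini'[OF m] by simp
  also have "\<dots> \<le> (\<integral>\<^sup>+y. c * indicator U y \<partial>\<nu>)"
  proof (rule nn_integral_mono_AE, use conc(2) in eventually_elim)
    fix y assume "y \<in> M"
    have "(\<integral>\<^sup>+x. indicator A x * indicator {p. dist (fst p) (snd p) < e} (x, y) \<partial>\<mu>)
       \<le> (\<integral>\<^sup>+x. indicator U y * indicator (ball y e) x \<partial>\<mu>)"
      by (intro nn_integral_mono) (auto split: split_indicator simp: U_def dist_commute)
    also have "\<dots> = indicator U y * c"
      using sets balls(1)[OF \<open>y \<in> M\<close>] by (subst nn_integral_cmult_indicator) auto
    finally show "(\<integral>\<^sup>+x. indicator A x * indicator {p. dist (fst p) (snd p) < e} (x, y) \<partial>\<mu>)
       \<le> c * indicator U y" by (simp add: mult.commute)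
  qed
  also have "\<dots> = c * emeasure \<nu> U"
    using U sets by (simp add: nn_integral_cmult_indicator)
  finally show ?thesis
    using c unfolding U_def[symmetric] by (simp add: ennreal_mult_le_mult_iff)
qed

text \<open>A point of the intersection has points of \<open>A\<close> at distance below every
  \<open>1 / (n + 1)\<close>, so it lies in the closure of \<open>A\<close>.\<close>

lemma Inter_nhd_compact:
  fixes A :: "'a::metric_space set"
  assumes "compact A"
  shows "(\<Inter>n. \<Union>x\<in>A. ball x (1 / real (Suc n))) = A"
proof (intro set_eqI iffI)
  fix y assume y: "y \<in> (\<Inter>n. \<Union>x\<in>A. ball x (1 / real (Suc n)))"
  have "\<exists>x\<in>A. dist x y < e" if "e > 0" for e
  proof -
    obtain n where "1 / real (Suc n) < e" using \<open>e > 0\<close> nat_approx_posE by blast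
    moreover obtain x where "x \<in> A" "dist x y < 1 / real (Suc n)" using y by auto
    ultimately show ?thesis by force
  qed
  then have "y \<in> closure A" by (auto simp: closure_approachable)
  then show "y \<in> A" using assms by (simp add: compact_imp_closed)
next
  fix y assume "y \<in> A"
  then show "y \<in> (\<Inter>n. \<Union>x\<in>A. ball x (1 / real (Suc n)))" by (auto intro!: bexI[of _ y])
qed

text \<open>The neighbourhood bound is used with radii \<open>1 / (n + 1)\<close>. These
  neighbourhoods decrease to \<open>A\<close> and have finite mass, so continuity from above yields
  the limit.\<close>

lemma uniform_balls_le:
  fixes \<mu> \<nu> :: "'a::{heine_borel, second_countable_topology} measure"
  assumes sets: "sets \<mu> = sets borel" "sets \<nu> = sets borel"
    and fin: "sigma_finite_measure \<mu>" "sigma_finite_measure \<nu>"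
    and bounded: "\<And>A. bounded A \<Longrightarrow> emeasure \<nu> A < \<infinity>"
    and conc: "AE x in \<mu>. x \<in> M" "AE x in \<nu>. x \<in> M"
    and balls: "\<And>e. e > 0 \<Longrightarrow> \<exists>c>0. c < \<infinity> \<and>
       (\<forall>y\<in>M. emeasure \<mu> (ball y e) = c \<and> emeasure \<nu> (ball y e) = c)"
    and A: "compact A"
  shows "emeasure \<mu> A \<le> emeasure \<nu> A"
proof -
  let ?U = "\<lambda>n. \<Union>x\<in>A. ball x (1 / real (Suc n))"
  have "(\<lambda>n. emeasure \<nu> (?U n)) \<longlonglongrightarrow> emeasure \<nu> (\<Inter>n. ?U n)"
  proof (rule Lim_emeasure_decseq)
    show "range ?U \<subseteq> sets \<nu>" unfolding sets by (auto intro!: borel_open)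
    show "decseq ?U"
    proof (rule decseq_SucI, rule UN_mono[OF order_refl], rule subset_ball)
      fix n show "1 / real (Suc (Suc n)) \<le> 1 / real (Suc n)" by (simp add: frac_le)
    qed
    fix n
    \<comment> \<open>The radii never exceed 1, so a closed ball containing \<open>A\<close>,
      enlarged by 1, contains every neighbourhood.\<close>
    have "bounded (?U n)"
    proof -
      have "bounded A" using A by (rule compact_imp_bounded)
      then obtain a b where ab: "\<And>x. x \<in> A \<Longrightarrow> dist a x \<le> b"
        unfolding bounded_def by blast
      have "?U n \<subseteq> cball a (b + 1)"
      proof
        fix y assume "y \<in> ?U n"
        then obtain x where x: "x \<in> A" "dist x y < 1 / real (Suc n)" by auto
        have "1 / real (Suc n) \<le> 1" by simp
        then show "y \<in> cball a (b + 1)"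
          using ab[OF x(1)] x(2) dist_triangle[of a y x] unfolding mem_cball by linarith
      qed
      then show ?thesis by (rule bounded_subset[OF bounded_cball])
    qed
    then show "emeasure \<nu> (?U n) \<noteq> \<infinity>" using bounded[of "?U n"] by auto
  qed
  then have "(\<lambda>n. emeasure \<nu> (?U n)) \<longlonglongrightarrow> emeasure \<nu> A"
    using Inter_nhd_compact[OF A] by simp
  moreover have "emeasure \<mu> A \<le> emeasure \<nu> (?U n)" for n
  proof -
    have "1 / real (Suc n) > 0" by simp
    from balls[OF this] obtain c where "c > 0" "c < \<infinity>"
      "\<forall>y\<in>M. emeasure \<mu> (ball y (1 / real (Suc n))) = c \<and> emeasure \<nu> (ball y (1 / real (Suc n))) = c"
      by blast
    then show ?thesis
      using A by (intro uniform_balls_le_nhd[OF sets fin conc]) (auto intro: borel_compact)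
  qed
  ultimately show ?thesis
    by (intro LIMSEQ_le_const) auto
qed

text \<open>The classical uniqueness of uniformly distributed measures. The hypotheses are symmetric
  in the two measures, so the preceding inequality holds both ways on compact sets, and these
  generate the Borel sets.\<close>

lemma uniform_balls_eq:
  fixes \<mu> \<nu> :: "'a::{heine_borel, second_countable_topology} measure"
  assumes sets: "sets \<mu> = sets borel" "sets \<nu> = sets borel"
    and bounded: "\<And>A. bounded A \<Longrightarrow> emeasure \<mu> A < \<infinity>" "\<And>A. bounded A \<Longrightarrow> emeasure \<nu> A < \<infinity>"
    and conc: "AE x in \<mu>. x \<in> M" "AE x in \<nu>. x \<in> M"
    and balls: "\<And>e. e > 0 \<Longrightarrow> \<exists>c>0. c < \<infinity> \<and>
       (\<forall>y\<in>M. emeasure \<mu> (ball y e) = c \<and> emeasure \<nu> (ball y e) = c)"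
  shows "\<mu> = \<nu>"
proof -
  obtain a :: 'a where True by simp
  have UN: "(\<Union>n. cball a (real n)) = UNIV"
    using real_arch_simple by (auto simp: mem_cball)
  have sigma_finite: "sigma_finite_measure \<kappa>"
    if "sets \<kappa> = sets borel" "\<And>A. bounded A \<Longrightarrow> emeasure \<kappa> A < \<infinity>" for \<kappa> :: "'a measure"
  proof
    show "\<exists>A. countable A \<and> A \<subseteq> sets \<kappa> \<and> \<Union> A = space \<kappa> \<and> (\<forall>a\<in>A. emeasure \<kappa> a \<noteq> \<infinity>)"
      using that(2)[OF bounded_cball] that(1) UN sets_eq_imp_space_eq[OF that(1)]
      by (intro exI[of _ "range (\<lambda>n. cball a (real n))"]) (auto simp: less_top[symmetric])
  qed
  note fin = sigma_finite[OF sets(1) bounded(1)] sigma_finite[OF sets(2) bounded(2)]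
  have eq: "emeasure \<mu> A = emeasure \<nu> A" if "compact A" for A
  proof (rule antisym)
    show "emeasure \<mu> A \<le> emeasure \<nu> A"
      using uniform_balls_le[OF sets fin bounded(2) conc balls that] .
    show "emeasure \<nu> A \<le> emeasure \<mu> A"
    proof (rule uniform_balls_le[OF sets(2,1) fin(2,1) bounded(1) conc(2,1) _ that])
      show "\<exists>c>0. c < \<infinity> \<and> (\<forall>y\<in>M. emeasure \<nu> (ball y e) = c \<and> emeasure \<mu> (ball y e) = c)"
        if "e > 0" for e using balls[OF that] by blast
    qed
  qed
  show ?thesis
  proof (rule measure_eqI_generator_eq[where E = "Collect compact" and \<Omega> = UNIV
        and A = "\<lambda>n. cball a (real n)"])
    show "Int_stable (Collect compact :: 'a set set)" by (auto simp: Int_stable_def compact_Int)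
    show "sets \<mu> = sigma_sets UNIV (Collect compact)" "sets \<nu> = sigma_sets UNIV (Collect compact)"
      unfolding sets by (simp_all add: borel_eq_compact)
    show "emeasure \<mu> (cball a (real i)) \<noteq> \<infinity>" for i
      using bounded(1)[OF bounded_cball] by (auto simp: less_top[symmetric])
  qed (use eq UN in auto)
qed

text \<open>Uniqueness of an invariant probability measure, reduced to ball masses: since
  \<open>G\<close> moves any point of \<open>M\<close> to any other by isometries, balls of radius
  \<open>e\<close> centred in \<open>M\<close> all have the same mass, for either measure. What
  remains is that the two constants agree and are positive.\<close>

lemma invariant_prob_eq:
  fixes \<mu> \<nu> :: "'a::{heine_borel, second_countable_topology} measure"
  assumes sets: "sets \<mu> = sets borel" "sets \<nu> = sets borel"
    and prob: "prob_space \<mu>" "prob_space \<nu>"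
    and M: "compact M"
    and conc: "AE x in \<mu>. x \<in> M" "AE x in \<nu>. x \<in> M"
    and meas: "\<And>T. T \<in> G \<Longrightarrow> T \<in> borel_measurable borel"
    and isom: "\<And>T x y. T \<in> G \<Longrightarrow> dist (T x) (T y) = dist x y"
    and trans: "\<And>x y. x \<in> M \<Longrightarrow> y \<in> M \<Longrightarrow> \<exists>T\<in>G. T x = y"
    and inv: "\<And>T. T \<in> G \<Longrightarrow> distr \<mu> borel T = \<mu>" "\<And>T. T \<in> G \<Longrightarrow> distr \<nu> borel T = \<nu>"
  shows "\<mu> = \<nu>"
proof (rule uniform_balls_eq[OF sets _ _ conc])
  interpret mu: prob_space \<mu> by fact
  interpret nu: prob_space \<nu> by fact
  interpret P: pair_sigma_finite \<mu> \<nu> ..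
  show "emeasure \<mu> A < \<infinity>" "emeasure \<nu> A < \<infinity>" for A
    by (auto simp: less_top[symmetric])
  fix e :: real assume "e > 0"
  have const: "emeasure \<kappa> (ball y e) = emeasure \<kappa> (ball x e)"
    if "x \<in> M" "y \<in> M" and sk: "sets \<kappa> = sets borel" and k: "\<And>T. T \<in> G \<Longrightarrow> distr \<kappa> borel T = \<kappa>"
    for x y and \<kappa> :: "'a measure"
  proof -
    obtain T where T: "T \<in> G" "T x = y" using trans \<open>x \<in> M\<close> \<open>y \<in> M\<close> by blast
    have sp: "space \<kappa> = UNIV" using sets_eq_imp_space_eq[OF sk] by simp
    have "emeasure \<kappa> (ball y e) = emeasure (distr \<kappa> borel T) (ball y e)"
      using k[OF T(1)] by simp
    also have "\<dots> = emeasure \<kappa> (T -` ball y e \<inter> space \<kappa>)"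
      using meas[OF T(1)] sk by (intro emeasure_distr) (auto cong: measurable_cong_sets)
    also have "T -` ball y e \<inter> space \<kappa> = ball x e"
      using isom[OF T(1)] T(2) sp by (auto simp: mem_ball)
    finally show ?thesis .
  qed
  have "M \<noteq> {}"
  proof
    assume "M = {}"
    then have "AE x in \<mu>. False" using conc(1) by simp
    then show False by simp
  qed
  then obtain z where z: "z \<in> M" by blast
  define c where "c = emeasure \<mu> (ball z e)"
  define d where "d = emeasure \<nu> (ball z e)"
  have c: "emeasure \<mu> (ball y e) = c" if "y \<in> M" for y
    using const[OF z that sets(1) inv(1)] by (simp add: c_def)
  have d: "emeasure \<nu> (ball y e) = d" if "y \<in> M" for y
    using const[OF z that sets(2) inv(2)] by (simp add: d_def)
  have m: "(\<lambda>(x, y). indicator {p. dist (fst p) (snd p) < e} (x, y) :: ennreal)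
      \<in> borel_measurable (\<mu> \<Otimes>\<^sub>M \<nu>)"
  proof -
    have "(\<lambda>p. indicator {p :: 'a \<times> 'a. dist (fst p) (snd p) < e} p :: ennreal)
      \<in> borel_measurable (borel \<Otimes>\<^sub>M borel)" by (rule borel_measurable_indicator[OF borel_dist_less])
    then show ?thesis
      unfolding split_beta' prod.collapse measurable_cong_sets[OF sets_pair_measure_cong[OF sets] refl] .
  qed
  \<comment> \<open>The product mass of the pairs at distance less than \<open>e\<close> is computed
    in both orders. As both measures have total mass 1, one order gives \<open>d\<close> and the
    other gives \<open>c\<close>.\<close>
  have "d = (\<integral>\<^sup>+x. d \<partial>\<mu>)" by (simp add: mu.emeasure_space_1)
  also have "\<dots> = (\<integral>\<^sup>+x. (\<integral>\<^sup>+y. indicator {p. dist (fst p) (snd p) < e} (x, y) \<partial>\<nu>) \<partial>\<mu>)"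
  proof (rule nn_integral_cong_AE, use conc(1) in eventually_elim)
    fix x assume "x \<in> M"
    have "(\<integral>\<^sup>+y. indicator {p. dist (fst p) (snd p) < e} (x, y) \<partial>\<nu>)
      = (\<integral>\<^sup>+y. indicator (ball x e) y \<partial>\<nu>)"
      by (intro nn_integral_cong) (auto split: split_indicator)
    then show "d = (\<integral>\<^sup>+y. indicator {p. dist (fst p) (snd p) < e} (x, y) \<partial>\<nu>)"
      using sets d[OF \<open>x \<in> M\<close>] by simp
  qed
  also have "\<dots> = (\<integral>\<^sup>+y. (\<integral>\<^sup>+x. indicator {p. dist (fst p) (snd p) < e} (x, y) \<partial>\<mu>) \<partial>\<nu>)"
    using P.Fubini'[OF m] by simp
  also have "\<dots> = (\<integral>\<^sup>+y. c \<partial>\<nu>)"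
  proof (rule nn_integral_cong_AE, use conc(2) in eventually_elim)
    fix y assume "y \<in> M"
    have "(\<integral>\<^sup>+x. indicator {p. dist (fst p) (snd p) < e} (x, y) \<partial>\<mu>)
      = (\<integral>\<^sup>+x. indicator (ball y e) x \<partial>\<mu>)"
      by (intro nn_integral_cong) (auto split: split_indicator simp: dist_commute)
    then show "(\<integral>\<^sup>+x. indicator {p. dist (fst p) (snd p) < e} (x, y) \<partial>\<mu>) = c"
      using sets c[OF \<open>y \<in> M\<close>] by simp
  qed
  also have "\<dots> = c" by (simp add: nu.emeasure_space_1)
  finally have "d = c" .
  \<comment> \<open>Finitely many balls of radius \<open>e\<close> centred in \<open>M\<close> cover
    the compact set \<open>M\<close>; if they were null, the measure could not be concentrated on
    \<open>M\<close>.\<close>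
  have "c \<noteq> 0"
  proof
    assume "c = 0"
    obtain D where D: "finite D" "D \<subseteq> M" "M \<subseteq> (\<Union>x\<in>D. ball x e)"
    proof (rule compactE_image[OF M, of M "\<lambda>x. ball x e"])
      show "M \<subseteq> (\<Union>x\<in>M. ball x e)" using \<open>e > 0\<close> by (auto intro!: bexI)
    qed auto
    have "(\<Union>x\<in>D. ball x e) \<in> null_sets \<mu>"
      using D c \<open>c = 0\<close> sets by (intro null_sets_UN' countable_finite) (auto simp: null_sets_def)
    then have "AE x in \<mu>. x \<notin> (\<Union>x\<in>D. ball x e)" by (rule AE_not_in)
    with conc(1) have "AE x in \<mu>. False" by eventually_elim (use D in auto)
    then show False by simp
  qed
  then show "\<exists>c>0. c < \<infinity> \<and> (\<forall>y\<in>M. emeasure \<mu> (ball y e) = c \<and> emeasure \<nu> (ball y e) = c)"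
    using c d \<open>d = c\<close> by (intro exI[of _ c]) (auto simp: c_def less_top[symmetric] zero_less_iff_neq_zero)
qed

text \<open>The preimage of a ball under \<open>T\<close> is a ball of the same radius, and the
  Lebesgue mass of a ball depends only on its radius. So \<open>lborel\<close> and its image have
  the same ball masses at all centres.\<close>

lemma distr_lborel_orthogonal:
  fixes T :: "'a::euclidean_space \<Rightarrow> 'a"
  assumes T: "orthogonal_transformation T"
  shows "distr lborel borel T = lborel"
proof (rule uniform_balls_eq[where M = UNIV])
  have lin: "linear T" using T by (simp add: orthogonal_transformation_linear)
  then have [measurable]: "T \<in> borel_measurable borel"
    by (intro borel_measurable_continuous_onI linear_continuous_on linear_conv_bounded_linear[THEN iffD1])
  have vimage: "T -` ball y e = ball (inv T y) e" for y e
  proof -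
    have "dist y (T x) = dist (inv T y) x" for x
    proof -
      have "T (inv T y) = y" using orthogonal_transformation_surj[OF T] by (simp add: surj_f_inv_f)
      then have "dist y (T x) = dist (T (inv T y)) (T x)" by simp
      also have "\<dots> = norm (T (inv T y - x))" by (simp add: dist_norm linear_diff[OF lin])
      finally show ?thesis by (simp add: dist_norm orthogonal_transformation_norm[OF T])
    qed
    then show ?thesis by (auto simp: mem_ball)
  qed
  have ball: "emeasure (lborel :: 'a measure) (ball y e) = emeasure (lborel :: 'a measure) (ball 0 e)"
    if "e > 0" for y e using that by (simp add: emeasure_ball)
  have distr_ball: "emeasure (distr lborel borel T) (ball y e) = emeasure (lborel :: 'a measure) (ball 0 e)"
    if "e > 0" for y e
    using ball[OF that] by (simp add: emeasure_distr vimage)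
  show fin: "emeasure (lborel :: 'a measure) A < \<infinity>" if "bounded A" for A
    using emeasure_bounded_finite[OF that] .
  show "emeasure (distr lborel borel T) A < \<infinity>" if bA: "bounded A" for A
  proof -
    obtain r where "r > 0" "A \<subseteq> ball 0 r" using bounded_subset_ballD[OF bA] by blast
    then have "emeasure (distr lborel borel T) A \<le> emeasure (lborel :: 'a measure) (ball 0 r)"
      using distr_ball[of r 0] emeasure_mono[of A "ball 0 r" "distr lborel borel T"] by simp
    then show ?thesis using fin[of "ball 0 r"] by (meson bounded_ball order_le_less_trans)
  qed
  show "\<exists>c>0. c < \<infinity> \<and> (\<forall>y\<in>UNIV. emeasure (distr lborel borel T) (ball y e) = c \<and>
      emeasure (lborel :: 'a measure) (ball y e) = c)" if "e > 0" for e
    using that ball[OF that] distr_ball[OF that] fin[of "ball 0 e"]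
    by (intro exI[of _ "emeasure (lborel :: 'a measure) (ball 0 e)"])
       (auto simp: emeasure_ball unit_ball_vol_pos)
qed simp_all

subsection \<open>The invariant measure on a great subsphere\<close>

lemma orthogonal_transformation_swap:
  fixes a b :: "'a::euclidean_space"
  assumes "norm a = norm b"
  obtains T where "orthogonal_transformation T" "T a = b" "\<And>x. x \<bullet> a = x \<bullet> b \<Longrightarrow> T x = x"
proof
  define v where "v = a - b"
  \<comment> \<open>The reflection in the hyperplane orthogonal to \<open>a - b\<close>. For
    \<open>a = b\<close> the vector \<open>v\<close> is zero and the map is the identity.\<close>
  let ?T = "\<lambda>x. x - (2 * (x \<bullet> v) / (v \<bullet> v)) *\<^sub>R v"
  have "linear ?T"
    by (rule linearI) (simp_all add: algebra_simps inner_add_left add_divide_distrib)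
  then show "orthogonal_transformation ?T"
    unfolding orthogonal_transformation_def
    by (cases "v = 0") (simp_all add: inner_diff_left inner_diff_right inner_commute)
  have "v \<bullet> v = 2 * (a \<bullet> v)"
  proof -
    have "a \<bullet> a = b \<bullet> b" using assms by (simp add: norm_eq)
    then show ?thesis by (simp add: v_def inner_diff_left inner_diff_right inner_commute)
  qed
  then show "?T a = b" by (cases "v = 0") (auto simp: v_def)
  show "?T x = x" if "x \<bullet> a = x \<bullet> b" for x
    using that by (simp add: v_def inner_diff_right)
qed

text \<open>First \<open>a\<close> is moved to \<open>c\<close>, then the image of \<open>b\<close>
  is reflected to \<open>d\<close>. The second reflection fixes \<open>c\<close>, because
  \<open>c\<close> is orthogonal to both vectors it exchanges. This supplies transitivity both on
  subspheres and on orthonormal pairs.\<close>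

lemma orthogonal_transformation_frame:
  fixes a b c d :: "'a::euclidean_space"
  assumes "norm a = 1" "norm b = 1" "a \<bullet> b = 0" "norm c = 1" "norm d = 1" "c \<bullet> d = 0"
  obtains T where "orthogonal_transformation T" "T a = c" "T b = d"
proof -
  obtain T where T: "orthogonal_transformation T" "T a = c"
    using orthogonal_transformation_swap[of a c] assms by metis
  have "norm (T b) = 1" "c \<bullet> T b = 0"
    using T assms by (auto simp: orthogonal_transformation_norm)
      (metis orthogonal_transformation_def)
  then obtain R where R: "orthogonal_transformation R" "R (T b) = d" "\<And>x. x \<bullet> T b = x \<bullet> d \<Longrightarrow> R x = x"
    using orthogonal_transformation_swap[of "T b" d] assms by metis
  show ?thesis
  proof
    show "orthogonal_transformation (R \<circ> T)"
      using R(1) T(1) by (rule orthogonal_transformation_compose)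
    show "(R \<circ> T) a = c" using R(3)[of c] \<open>c \<bullet> T b = 0\<close> T(2) assms by simp
    show "(R \<circ> T) b = d" using R(2) by simp
  qed
qed

section \<open>Equivariance of norms, directions and projections under orthogonal maps\<close>

lemma orthogonal_transformation_borel:
  fixes T :: "'a::euclidean_space \<Rightarrow> 'a"
  shows "orthogonal_transformation T \<Longrightarrow> T \<in> borel_measurable borel"
  by (intro borel_measurable_continuous_onI linear_continuous_on
      linear_conv_bounded_linear[THEN iffD1] orthogonal_transformation_linear)

lemma orthogonal_transformation_dist:
  "orthogonal_transformation T \<Longrightarrow> dist (T x) (T y) = dist x y"
  by (simp add: dist_norm orthogonal_transformation_norm
      linear_diff[OF orthogonal_transformation_linear, symmetric])

lemma orthogonal_transformation_inner:
  "orthogonal_transformation T \<Longrightarrow> T x \<bullet> T y = x \<bullet> y"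
  by (simp add: orthogonal_transformation_def)

lemma orthogonal_transformation_sgn:
  "orthogonal_transformation T \<Longrightarrow> T (sgn x) = sgn (T x)"
  by (simp add: sgn_div_norm orthogonal_transformation_scaleR orthogonal_transformation_norm)

lemma orthogonal_transformation_proj_perp:
  "orthogonal_transformation T \<Longrightarrow> T (proj_perp \<omega> x) = proj_perp (T \<omega>) (T x)"
  by (simp add: proj_perp_def linear_diff[OF orthogonal_transformation_linear]
      orthogonal_transformation_scaleR orthogonal_transformation_inner)

lemma proj_perp_scaleR: "c \<noteq> 0 \<Longrightarrow> proj_perp (c *\<^sub>R \<omega>) x = proj_perp \<omega> x"
  by (simp add: proj_perp_def)

lemma proj_perp_sgn: "proj_perp (sgn \<omega>) x = proj_perp \<omega> x"
  by (cases "\<omega> = 0") (simp_all add: sgn_div_norm proj_perp_scaleR)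

lemma inner_proj_perp: "y \<in> perp \<omega> \<Longrightarrow> y \<bullet> proj_perp \<omega> x = y \<bullet> x"
  by (simp add: proj_perp_def perp_def inner_diff_right)

text \<open>All invariant measures below are images of the uniform measure on the unit ball under
  equivariant normalisation maps.\<close>

definition unit_ball_measure :: "'a::euclidean_space measure" where
  "unit_ball_measure = uniform_measure lborel (ball 0 1)"

lemma sets_unit_ball_measure [simp, measurable_cong]: "sets unit_ball_measure = sets borel"
  and space_unit_ball_measure [simp]: "space unit_ball_measure = UNIV"
  by (simp_all add: unit_ball_measure_def)

lemma emeasure_unit_ball:
  "emeasure (lborel :: 'a::euclidean_space measure) (ball 0 1) \<noteq> 0"
  "emeasure (lborel :: 'a::euclidean_space measure) (ball 0 1) \<noteq> \<infinity>"
  by (auto simp: emeasure_ball) (metis less_irrefl unit_ball_vol_pos of_nat_0_le_iff)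

lemma prob_space_unit_ball_measure: "prob_space unit_ball_measure"
  unfolding unit_ball_measure_def using emeasure_unit_ball by (rule prob_space_uniform_measure)

interpretation unit_ball: prob_space "unit_ball_measure :: 'a::euclidean_space measure"
  by (rule prob_space_unit_ball_measure)

lemma unit_ball_measure_orthogonal:
  fixes T :: "'a::euclidean_space \<Rightarrow> 'a"
  assumes "orthogonal_transformation T"
  shows "distr unit_ball_measure borel T = unit_ball_measure"
proof (rule measure_eqI)
  note [measurable] = orthogonal_transformation_borel[OF assms]
  fix A assume "A \<in> sets (distr unit_ball_measure borel T)"
  then have [measurable]: "A \<in> sets borel" by simp
  have m: "T -` A \<in> sets borel"
    using measurable_sets[OF orthogonal_transformation_borel[OF assms] \<open>A \<in> sets borel\<close>] by simp
  have "ball 0 1 \<inter> T -` A = T -` (ball 0 1 \<inter> A)"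
    by (auto simp: orthogonal_transformation_norm[OF assms])
  then have "emeasure lborel (ball 0 1 \<inter> T -` A) = emeasure (distr lborel borel T) (ball 0 1 \<inter> A)"
    by (simp add: emeasure_distr)
  then have "emeasure lborel (ball 0 1 \<inter> T -` A) = emeasure lborel (ball 0 1 \<inter> A)"
    by (simp add: distr_lborel_orthogonal[OF assms])
  then show "emeasure (distr unit_ball_measure borel T) A = emeasure unit_ball_measure A"
    using m by (simp add: emeasure_distr) (simp add: unit_ball_measure_def)
qed simp

lemma AE_unit_ball_negligible:
  assumes "negligible N"
  shows "AE x in unit_ball_measure. x \<notin> N"
proof -
  have "AE x in lborel. x \<notin> N"
    using AE_not_in[of N lebesgue] assms unfolding negligible_iff_null_sets AE_completion_iff by blast
  then show ?thesis unfolding unit_ball_measure_def by (intro AE_uniform_measureI) auto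
qed

text \<open>The projection vanishes only on the span of \<open>\<omega>\<close>, a proper subspace.
  The case \<open>\<omega> = 0\<close> is included: there the projection is the identity by division
  by zero, and the claim says that almost every \<open>x\<close> is nonzero.\<close>

lemma AE_unit_ball_proj_perp_nonzero:
  fixes \<omega> :: "'a::euclidean_space"
  assumes "DIM('a) \<ge> 2"
  shows "AE x in unit_ball_measure. proj_perp \<omega> x \<noteq> 0"
proof -
  have "dim {\<omega>} \<le> card {\<omega>}" by (rule dim_le_card') simp
  then have "dim (span {\<omega>}) < DIM('a)" using assms by simp
  then have "negligible (span {\<omega>})" by (rule negligible_lowdim)
  from AE_unit_ball_negligible[OF this] show ?thesis
  proof eventually_elim
    fix x assume "x \<notin> span {\<omega>}"
    moreover have "x \<in> span {\<omega>}" if "proj_perp \<omega> x = 0"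
    proof -
      have "x = ((x \<bullet> \<omega>) / (\<omega> \<bullet> \<omega>)) *\<^sub>R \<omega>" using that by (simp add: proj_perp_def)
      then show ?thesis by (metis span_base span_scale insertI1)
    qed
    ultimately show "proj_perp \<omega> x \<noteq> 0" by blast
  qed
qed

text \<open>Junk value \<open>0\<close>, outside the sphere, on the null set where \<open>x\<close> is parallel to \<open>\<omega>\<close>.\<close>

definition perp_dir :: "'a::euclidean_space \<Rightarrow> 'a \<Rightarrow> 'a" where
  "perp_dir \<omega> x = sgn (proj_perp \<omega> x)"

lemma perp_dir_borel_pair [measurable]:
  "(\<lambda>p. perp_dir (fst p) (snd p)) \<in> borel_measurable (borel \<Otimes>\<^sub>M borel)"
  unfolding perp_dir_def proj_perp_def by measurable

lemma perp_dir_borel [measurable]: "perp_dir \<omega> \<in> borel_measurable borel"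
  unfolding perp_dir_def proj_perp_def by measurable

lemma perp_dir_in_perp: "perp_dir \<omega> x \<in> perp \<omega>"
  using proj_perp_in_perp[of \<omega> x] by (simp add: perp_dir_def perp_def sgn_div_norm)

lemma perp_dir_in_sphere: "proj_perp \<omega> x \<noteq> 0 \<Longrightarrow> perp_dir \<omega> x \<in> unit_sphere \<inter> perp \<omega>"
  using perp_dir_in_perp[of \<omega> x] by (simp add: perp_dir_def norm_sgn)

lemma norm_perp_dir_le: "norm (perp_dir \<omega> x) \<le> 1"
  by (simp add: perp_dir_def norm_sgn)

lemma orthogonal_transformation_perp_dir:
  "orthogonal_transformation T \<Longrightarrow> T (perp_dir \<omega> x) = perp_dir (T \<omega>) (T x)"
  by (simp add: perp_dir_def orthogonal_transformation_sgn orthogonal_transformation_proj_perp)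

lemma AE_perp_dir:
  fixes \<omega> :: "'a::euclidean_space"
  assumes "DIM('a) \<ge> 2"
  shows "AE x in unit_ball_measure. perp_dir \<omega> x \<in> unit_sphere \<inter> perp \<omega>"
  using AE_unit_ball_proj_perp_nonzero[OF assms] by eventually_elim (rule perp_dir_in_sphere)

text \<open>The candidate for the invariant measure on the great subsphere, kept as a Borel measure
  on the whole space so that \<open>invariant_prob_eq\<close> can be applied to it before it is
  restricted.\<close>

definition perp_dir_law :: "'a::euclidean_space \<Rightarrow> 'a measure" where
  "perp_dir_law \<omega> = distr unit_ball_measure borel (perp_dir \<omega>)"

lemma sets_perp_dir_law [simp, measurable_cong]: "sets (perp_dir_law \<omega>) = sets borel"
  and space_perp_dir_law [simp]: "space (perp_dir_law \<omega>) = UNIV"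
  by (simp_all add: perp_dir_law_def)

lemma prob_space_perp_dir_law: "prob_space (perp_dir_law \<omega>)"
  unfolding perp_dir_law_def by (rule unit_ball.prob_space_distr) simp

text \<open>Applying \<open>T\<close> after \<open>perp_dir \<omega>\<close> is the same as applying
  \<open>perp_dir (T \<omega>)\<close> after \<open>T\<close>, and the inner \<open>T\<close>
  preserves the ball measure.\<close>

lemma distr_perp_dir_law:
  fixes T :: "'a::euclidean_space \<Rightarrow> 'a"
  assumes "orthogonal_transformation T"
  shows "distr (perp_dir_law \<omega>) borel T = perp_dir_law (T \<omega>)"
proof -
  note [measurable] = orthogonal_transformation_borel[OF assms]
  have "distr (perp_dir_law \<omega>) borel T = distr unit_ball_measure borel (perp_dir (T \<omega>) \<circ> T)"
    unfolding perp_dir_law_def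
    by (subst distr_distr) (auto simp: o_def orthogonal_transformation_perp_dir[OF assms])
  also have "\<dots> = distr (distr unit_ball_measure borel T) borel (perp_dir (T \<omega>))"
    by (subst distr_distr) auto
  finally show ?thesis by (simp add: unit_ball_measure_orthogonal[OF assms] perp_dir_law_def)
qed

section \<open>Identification of the subsphere measure\<close>

lemma closed_perp: "closed (perp \<omega>)"
  unfolding perp_def by (intro closed_Collect_eq continuous_intros)

lemma compact_subsphere: "compact (unit_sphere \<inter> perp \<omega>)"
  by (simp add: closed_perp compact_Int_closed)

lemma borel_subsphere: "unit_sphere \<inter> perp \<omega> \<in> sets borel"
  by (intro borel_compact compact_subsphere)

lemma AE_perp_dir_law:
  fixes \<omega> :: "'a::euclidean_space"
  assumes "DIM('a) \<ge> 2"
  shows "AE x in perp_dir_law \<omega>. x \<in> unit_sphere \<inter> perp \<omega>"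
  unfolding perp_dir_law_def
proof (subst AE_distr_iff)
  show "{x \<in> space borel. x \<in> unit_sphere \<inter> perp \<omega>} \<in> sets borel"
    using borel_subsphere[of \<omega>] by (simp only: space_borel Collect_mem_eq UNIV_I simp_thms)
qed (use AE_perp_dir[OF assms] in auto)

text \<open>The three properties demanded in \<open>subsphere_measure\<close>. Restriction loses no
  mass because the law is concentrated on the subsphere, and a \<open>T\<close> fixing
  \<open>\<omega>\<close> maps the subsphere into itself, so invariance survives.\<close>

lemma restrict_space_perp_dir_law:
  fixes \<omega> :: "'a::euclidean_space"
  assumes d: "DIM('a) \<ge> 2"
  defines "\<kappa> \<equiv> restrict_space (perp_dir_law \<omega>) (unit_sphere \<inter> perp \<omega>)"
  shows "sets \<kappa> = sets (restrict_space borel (unit_sphere \<inter> perp \<omega>))"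
    and "prob_space \<kappa>"
    and "\<And>T. orthogonal_transformation T \<Longrightarrow> T \<omega> = \<omega> \<Longrightarrow> distr \<kappa> \<kappa> T = \<kappa>"
proof -
  let ?S = "unit_sphere \<inter> perp \<omega>"
  interpret L: prob_space "perp_dir_law \<omega>" by (rule prob_space_perp_dir_law)
  note S = borel_subsphere[of \<omega>]
  show "sets \<kappa> = sets (restrict_space borel ?S)"
    unfolding \<kappa>_def by (rule sets_restrict_space_cong) simp
  have "emeasure (perp_dir_law \<omega>) ?S = 1"
    using L.emeasure_eq_1_AE[OF _ AE_perp_dir_law[OF d]] S by simp
  then show "prob_space \<kappa>"
    unfolding \<kappa>_def using S by (intro prob_space_restrict_space) auto
  fix T assume T: "orthogonal_transformation T" "T \<omega> = \<omega>"
  note [measurable] = orthogonal_transformation_borel[OF T(1)]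
  have TS: "T x \<in> ?S" if "x \<in> ?S" for x
    using that orthogonal_transformation_inner[OF T(1), of x \<omega>] T
    by (simp add: perp_def orthogonal_transformation_norm)
  have Tm: "T \<in> measurable \<kappa> \<kappa>"
    unfolding \<kappa>_def
  proof (rule measurable_restrict_space2)
    show "T \<in> measurable (restrict_space (perp_dir_law \<omega>) ?S) (perp_dir_law \<omega>)"
      by (rule measurable_restrict_space1) measurable
  qed (use TS in \<open>auto simp: space_restrict_space\<close>)
  have em: "emeasure \<kappa> A = emeasure (perp_dir_law \<omega>) A" if "A \<in> sets borel" "A \<subseteq> ?S" for A
    unfolding \<kappa>_def using S that by (intro emeasure_restrict_space) auto
  show "distr \<kappa> \<kappa> T = \<kappa>"
  proof (rule measure_eqI)
    fix A assume "A \<in> sets (distr \<kappa> \<kappa> T)"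
    then have A: "A \<in> sets \<kappa>" by simp
    then have A': "A \<in> sets borel" "A \<subseteq> ?S"
      using S by (auto simp: \<kappa>_def sets_restrict_space)
    have TA: "T -` A \<in> sets borel"
      using measurable_sets[OF orthogonal_transformation_borel[OF T(1)] A'(1)] by simp
    have "emeasure (distr \<kappa> \<kappa> T) A = emeasure \<kappa> (T -` A \<inter> space \<kappa>)"
      using Tm A by (rule emeasure_distr)
    also have "\<dots> = emeasure (perp_dir_law \<omega>) (T -` A \<inter> ?S)"
    proof -
      have "space \<kappa> = ?S" by (simp add: \<kappa>_def space_restrict_space)
      then show ?thesis using TA S by (subst em) (auto intro: sets.Int)
    qed
    also have "\<dots> = emeasure (perp_dir_law \<omega>) (T -` A)"
    proof (rule emeasure_eq_AE)
      show "AE x in perp_dir_law \<omega>. x \<in> T -` A \<inter> ?S \<longleftrightarrow> x \<in> T -` A"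
        using AE_perp_dir_law[OF d] by eventually_elim auto
    qed (use TA S in auto)
    also have "\<dots> = emeasure (distr (perp_dir_law \<omega>) borel T) A"
      using A' by (simp add: emeasure_distr)
    also have "\<dots> = emeasure \<kappa> A"
      by (simp add: distr_perp_dir_law[OF T(1)] T(2) em[OF A'])
    finally show "emeasure (distr \<kappa> \<kappa> T) A = emeasure \<kappa> A" .
  qed simp
qed

text \<open>Resolves the definite description. Any competitor is pushed to the whole space along the
  inclusion and compared there with \<open>perp_dir_law \<omega>\<close>; the stabiliser of
  \<open>\<omega>\<close> is transitive on the subsphere, since the pair of \<open>\<omega>\<close>
  and \<open>x\<close> can be moved to that of \<open>\<omega>\<close> and \<open>y\<close>.\<close>

lemma subsphere_measure_eq:
  fixes \<omega> :: "'a::euclidean_space"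
  assumes d: "DIM('a) \<ge> 2" and \<omega>: "norm \<omega> = 1"
  shows "subsphere_measure \<omega> = restrict_space (perp_dir_law \<omega>) (unit_sphere \<inter> perp \<omega>)"
  unfolding subsphere_measure_def
proof (rule the_equality, intro conjI allI impI, goal_cases)
  case 1 show ?case by (rule restrict_space_perp_dir_law(1)[OF d])
next
  case 2 show ?case by (rule restrict_space_perp_dir_law(2)[OF d])
next
  case (3 T) then show ?case using restrict_space_perp_dir_law(3)[OF d] by blast
next
  case (4 \<mu>)
  let ?S = "unit_sphere \<inter> perp \<omega>"
  have sets: "sets \<mu> = sets (restrict_space borel ?S)" and "prob_space \<mu>"
    and inv: "\<And>T. orthogonal_transformation T \<Longrightarrow> T \<omega> = \<omega> \<Longrightarrow> distr \<mu> \<mu> T = \<mu>"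
    using 4 by auto
  interpret mu: prob_space \<mu> by fact
  note S = borel_subsphere[of \<omega>]
  have space: "space \<mu> = ?S"
    using sets_eq_imp_space_eq[OF sets] by (simp add: space_restrict_space)
  have m: "f \<in> borel_measurable \<mu>" if "f \<in> borel_measurable borel" for f :: "'a \<Rightarrow> 'a"
    unfolding measurable_cong_sets[OF sets refl] using that by (rule measurable_restrict_space1)
  have mid: "(\<lambda>x. x) \<in> borel_measurable \<mu>" by (rule m) simp
  have eq: "distr \<mu> borel (\<lambda>x. x) = perp_dir_law \<omega>"
  proof (rule invariant_prob_eq[where M = ?S
        and G = "{T. orthogonal_transformation T \<and> T \<omega> = \<omega>}"])
    show "prob_space (distr \<mu> borel (\<lambda>x. x))"
      by (rule mu.prob_space_distr) (rule mid)
    show "AE x in distr \<mu> borel (\<lambda>x. x). x \<in> ?S"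
    proof (subst AE_distr_iff)
      show "{x \<in> space borel. x \<in> ?S} \<in> sets borel"
        using S by (simp only: space_borel Collect_mem_eq UNIV_I simp_thms)
    qed (auto simp: mid space intro!: AE_I2)
    show "\<exists>T\<in>{T. orthogonal_transformation T \<and> T \<omega> = \<omega>}. T x = y" if "x \<in> ?S" "y \<in> ?S" for x y
    proof -
      have "norm x = 1" "\<omega> \<bullet> x = 0" "norm y = 1" "\<omega> \<bullet> y = 0"
        using that by (auto simp: perp_def inner_commute)
      then show ?thesis
        using orthogonal_transformation_frame[of \<omega> x \<omega> y] \<omega> by blast
    qed
    show "distr (perp_dir_law \<omega>) borel T = perp_dir_law \<omega>"
      if "T \<in> {T. orthogonal_transformation T \<and> T \<omega> = \<omega>}" for T
      using that distr_perp_dir_law[of T \<omega>] by simp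
    show "distr (distr \<mu> borel (\<lambda>x. x)) borel T = distr \<mu> borel (\<lambda>x. x)"
      if "T \<in> {T. orthogonal_transformation T \<and> T \<omega> = \<omega>}" for T
    proof -
      have T: "orthogonal_transformation T" "T \<omega> = \<omega>" using that by auto
      note Tb = orthogonal_transformation_borel[OF T(1)]
      have "T x \<in> ?S" if "x \<in> ?S" for x
        using that orthogonal_transformation_inner[OF T(1), of x \<omega>] T
        by (simp add: perp_def orthogonal_transformation_norm)
      then have "T \<in> measurable \<mu> (restrict_space borel ?S)"
        using m[OF Tb] by (intro measurable_restrict_space2) (auto simp: space)
      then have Tm: "T \<in> measurable \<mu> \<mu>"
        by (simp add: measurable_cong_sets[OF refl sets])
      have "distr (distr \<mu> borel (\<lambda>x. x)) borel T = distr \<mu> borel T"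
        using Tb mid by (subst distr_distr) (simp_all add: o_def)
      also have "\<dots> = distr (distr \<mu> \<mu> T) borel (\<lambda>x. x)"
        using Tm mid by (subst distr_distr) (simp_all add: o_def)
      finally show ?thesis using inv[OF T] by simp
    qed
  qed (auto simp: compact_subsphere prob_space_perp_dir_law AE_perp_dir_law[OF d, simplified]
      orthogonal_transformation_borel orthogonal_transformation_dist)
  show ?case
  proof (rule measure_eqI)
    show "sets \<mu> = sets (restrict_space (perp_dir_law \<omega>) ?S)"
      unfolding sets by (rule sets_restrict_space_cong) simp
    fix A assume "A \<in> sets \<mu>"
    then have A: "A \<in> sets borel" "A \<subseteq> ?S"
      using S by (auto simp: sets sets_restrict_space)
    have "emeasure (restrict_space (perp_dir_law \<omega>) ?S) A = emeasure (perp_dir_law \<omega>) A"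
      using S A by (intro emeasure_restrict_space) auto
    also have "\<dots> = emeasure (distr \<mu> borel (\<lambda>x. x)) A" by (simp add: eq)
    also have "\<dots> = emeasure \<mu> A"
      using A mid space by (subst emeasure_distr) (auto simp: Int_absorb2)
    finally show "emeasure \<mu> A = emeasure (restrict_space (perp_dir_law \<omega>) ?S) A" ..
  qed
qed

lemma space_subsphere_measure:
  fixes \<omega> :: "'a::euclidean_space"
  assumes "DIM('a) \<ge> 2" "norm \<omega> = 1"
  shows "space (subsphere_measure \<omega>) = unit_sphere \<inter> perp \<omega>"
  by (simp add: subsphere_measure_eq[OF assms] space_restrict_space)

text \<open>Writes the integral over one fixed probability space, with \<open>\<omega>\<close>
  occurring only in the integrand. This is what allows \<open>\<omega>\<close> itself to be
  integrated later by Fubini.\<close>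

lemma integral_subsphere_measure:
  fixes \<omega> :: "'a::euclidean_space" and g :: "'a \<Rightarrow> 'b::{banach, second_countable_topology}"
  assumes d: "DIM('a) \<ge> 2" and \<omega>: "norm \<omega> = 1" and g [measurable]: "g \<in> borel_measurable borel"
  shows "(LINT \<theta>|subsphere_measure \<omega>. g \<theta>) = (LINT x|unit_ball_measure. g (perp_dir \<omega> x))"
proof -
  let ?S = "unit_sphere \<inter> perp \<omega>"
  note S [measurable] = borel_subsphere[of \<omega>]
  have "(LINT \<theta>|subsphere_measure \<omega>. g \<theta>) = (LINT \<theta>|perp_dir_law \<omega>. indicator ?S \<theta> *\<^sub>R g \<theta>)"
    unfolding subsphere_measure_eq[OF d \<omega>] using S by (subst integral_restrict_space) auto
  also have "\<dots> = (LINT \<theta>|perp_dir_law \<omega>. g \<theta>)"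
  proof (rule integral_cong_AE)
    show "AE \<theta> in perp_dir_law \<omega>. indicator ?S \<theta> *\<^sub>R g \<theta> = g \<theta>"
      using AE_perp_dir_law[OF d] by eventually_elim simp
  qed measurable
  finally show ?thesis by (simp add: perp_dir_law_def integral_distr)
qed

subsection \<open>Self-adjointness of the Funk transform\<close>

interpretation unit_ball_pair: pair_prob_space
  "unit_ball_measure :: 'a::euclidean_space measure" "unit_ball_measure :: 'a measure" ..

lemma sets_unit_ball_pair [measurable_cong]:
  "sets (unit_ball_measure \<Otimes>\<^sub>M unit_ball_measure :: ('a::euclidean_space \<times> 'a) measure)
    = sets (borel \<Otimes>\<^sub>M borel)"
  by (intro sets_pair_measure_cong) simp_all

lemma perp_dir_sgn: "perp_dir (sgn \<omega>) x = perp_dir \<omega> x"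
  by (simp add: perp_dir_def proj_perp_sgn)

lemma AE_unit_ball_nonzero:
  assumes "DIM('a::euclidean_space) \<ge> 2"
  shows "AE x in (unit_ball_measure :: 'a measure). x \<noteq> 0"
  using AE_unit_ball_proj_perp_nonzero[OF assms, of 0] by (simp add: proj_perp_def)

text \<open>Gram-Schmidt on two points: for independent points of the ball this is almost surely an
  orthonormal pair, whose second entry, given the first, follows the subsphere measure.\<close>

definition flag :: "'a::euclidean_space \<times> 'a \<Rightarrow> 'a \<times> 'a" where
  "flag p = (sgn (fst p), perp_dir (fst p) (snd p))"

lemma flag_borel [measurable]:
  "(flag :: 'a::euclidean_space \<times> 'a \<Rightarrow> _) \<in> borel_measurable (borel \<Otimes>\<^sub>M borel)"
proof -
  have "(flag :: 'a \<times> 'a \<Rightarrow> _) \<in> measurable (borel \<Otimes>\<^sub>M borel) (borel \<Otimes>\<^sub>M borel)"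
    unfolding flag_def by measurable
  then show ?thesis by (simp add: borel_prod)
qed

definition flag_law :: "('a::euclidean_space \<times> 'a) measure" where
  "flag_law = distr (unit_ball_measure \<Otimes>\<^sub>M unit_ball_measure) borel flag"

definition flags :: "('a::euclidean_space \<times> 'a) set" where
  "flags = {p. norm (fst p) = 1 \<and> norm (snd p) = 1 \<and> fst p \<bullet> snd p = 0}"

lemma compact_flags: "compact (flags :: ('a::euclidean_space \<times> 'a) set)"
  unfolding compact_eq_bounded_closed
proof
  have "flags \<subseteq> sphere 0 1 \<times> (sphere 0 1 :: 'a set)" by (auto simp: flags_def)
  then show "bounded (flags :: ('a \<times> 'a) set)"
    by (rule bounded_subset[rotated]) (intro bounded_Times bounded_sphere)
  show "closed (flags :: ('a \<times> 'a) set)"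
    unfolding flags_def by (intro closed_Collect_conj closed_Collect_eq continuous_intros)
qed

lemma flag_in_flags: "y \<noteq> 0 \<Longrightarrow> proj_perp y x \<noteq> 0 \<Longrightarrow> flag (y, x) \<in> flags"
  using perp_dir_in_sphere[of y x]
  by (auto simp: flag_def flags_def norm_sgn perp_def sgn_div_norm inner_commute)

lemma AE_flag:
  assumes d: "DIM('a::euclidean_space) \<ge> 2"
  shows "AE p in unit_ball_measure \<Otimes>\<^sub>M unit_ball_measure. flag p \<in> (flags :: ('a \<times> 'a) set)"
proof (rule unit_ball_pair.AE_pair_measure)
  have "flags \<in> sets (borel :: ('a \<times> 'a) measure)"
    by (intro borel_compact compact_flags)
  from measurable_sets[OF flag_borel this]
  show "{p \<in> space (unit_ball_measure \<Otimes>\<^sub>M unit_ball_measure). flag p \<in> (flags :: ('a \<times> 'a) set)}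
      \<in> sets (unit_ball_measure \<Otimes>\<^sub>M unit_ball_measure)"
    by (simp add: sets_unit_ball_pair space_pair_measure vimage_def Int_def Collect_conj_eq)
  show "AE y in unit_ball_measure. AE x in unit_ball_measure. flag (y, x) \<in> (flags :: ('a \<times> 'a) set)"
    using AE_unit_ball_nonzero[OF d]
  proof eventually_elim
    fix y :: 'a assume "y \<noteq> 0"
    then show "AE x in unit_ball_measure. flag (y, x) \<in> flags"
      using AE_unit_ball_proj_perp_nonzero[OF d, of y] by (auto elim: eventually_mono intro: flag_in_flags)
  qed
qed

text \<open>The product of the ball measures is invariant under \<open>T\<close> acting on both
  entries, and \<open>flag\<close> commutes with this action.\<close>

lemma distr_flag_law:
  fixes T :: "'a::euclidean_space \<Rightarrow> 'a"
  assumes T: "orthogonal_transformation T"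
  shows "distr flag_law borel (map_prod T T) = flag_law"
proof -
  note Tb [measurable] = orthogonal_transformation_borel[OF T]
  have TT: "map_prod T T \<in> measurable (borel \<Otimes>\<^sub>M borel) (borel \<Otimes>\<^sub>M borel)"
    unfolding map_prod_def by measurable
  have "distr (unit_ball_measure \<Otimes>\<^sub>M unit_ball_measure) (borel \<Otimes>\<^sub>M borel) (map_prod T T)
      = distr unit_ball_measure borel T \<Otimes>\<^sub>M distr unit_ball_measure borel T"
    unfolding map_prod_def
    by (rule pair_measure_distr[symmetric])
       (simp_all add: unit_ball_measure_orthogonal[OF T] unit_ball.sigma_finite_measure_axioms)
  then have inv: "distr (unit_ball_measure \<Otimes>\<^sub>M unit_ball_measure) (borel \<Otimes>\<^sub>M borel) (map_prod T T)
      = unit_ball_measure \<Otimes>\<^sub>M unit_ball_measure"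
    by (simp add: unit_ball_measure_orthogonal[OF T])
  have "distr flag_law borel (map_prod T T) =
      distr (unit_ball_measure \<Otimes>\<^sub>M unit_ball_measure) borel (map_prod T T \<circ> flag)"
    unfolding flag_law_def using TT by (subst distr_distr) (simp_all add: borel_prod)
  also have "map_prod T T \<circ> flag = flag \<circ> map_prod T T"
    by (auto simp: flag_def fun_eq_iff orthogonal_transformation_sgn[OF T]
        orthogonal_transformation_perp_dir[OF T])
  also have "distr (unit_ball_measure \<Otimes>\<^sub>M unit_ball_measure) borel (flag \<circ> map_prod T T) =
      distr (distr (unit_ball_measure \<Otimes>\<^sub>M unit_ball_measure) (borel \<Otimes>\<^sub>M borel) (map_prod T T)) borel flag"
    using TT flag_borel
    by (subst distr_distr) (simp_all add: measurable_cong_sets[OF sets_unit_ball_pair refl])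
  finally show ?thesis by (simp add: inv flag_law_def)
qed

text \<open>Swapping commutes with the diagonal action of the orthogonal maps, so the swapped law is
  invariant as well. That action is isometric and transitive on orthonormal pairs, hence
  \<open>invariant_prob_eq\<close> identifies the two laws.\<close>

lemma distr_flag_law_swap:
  assumes d: "DIM('a::euclidean_space) \<ge> 2"
  shows "distr flag_law borel prod.swap = (flag_law :: ('a \<times> 'a) measure)"
proof (rule invariant_prob_eq[where M = flags and G = "{map_prod T T | T. orthogonal_transformation T}"])
  have fl: "flags \<in> sets (borel :: ('a \<times> 'a) measure)"
    by (intro borel_compact compact_flags)
  have swap [measurable]: "prod.swap \<in> borel_measurable (borel :: ('a \<times> 'a) measure)"
    unfolding prod.swap_def by (intro borel_measurable_continuous_onI continuous_intros)
  have Tb: "map_prod T T \<in> borel_measurable (borel :: ('a \<times> 'a) measure)"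
    if "orthogonal_transformation T" for T :: "'a \<Rightarrow> 'a"
  proof -
    note [measurable] = orthogonal_transformation_borel[OF that]
    have "map_prod T T \<in> measurable (borel \<Otimes>\<^sub>M borel) (borel \<Otimes>\<^sub>M borel)"
      unfolding map_prod_def by measurable
    then show ?thesis by (simp add: borel_prod)
  qed
  show p: "prob_space (flag_law :: ('a \<times> 'a) measure)"
    unfolding flag_law_def by (intro unit_ball_pair.P.prob_space_distr) simp
  show "prob_space (distr flag_law borel prod.swap :: ('a \<times> 'a) measure)"
    by (intro prob_space.prob_space_distr[OF p]) (simp add: flag_law_def)
  show ae: "AE x in (flag_law :: ('a \<times> 'a) measure). x \<in> flags"
    unfolding flag_law_def using fl by (subst AE_distr_iff) (use AE_flag[OF d] in auto)
  show "AE x in (distr flag_law borel prod.swap :: ('a \<times> 'a) measure). x \<in> flags"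
    using fl ae
    by (subst AE_distr_iff) (auto simp: flag_law_def flags_def inner_commute elim!: eventually_mono)
  show "compact (flags :: ('a \<times> 'a) set)" by (rule compact_flags)
  show "sets (distr flag_law borel prod.swap :: ('a \<times> 'a) measure) = sets borel"
    "sets (flag_law :: ('a \<times> 'a) measure) = sets borel"
    by (simp_all add: flag_law_def)
  fix R :: "'a \<times> 'a \<Rightarrow> 'a \<times> 'a"
  assume "R \<in> {map_prod T T | T. orthogonal_transformation T}"
  then obtain T where T: "orthogonal_transformation T" and R: "R = map_prod T T" by blast
  show "R \<in> borel_measurable borel" using Tb[OF T] R by simp
  show "dist (R x) (R y) = dist x y" for x y
    by (cases x; cases y) (simp add: R dist_Pair_Pair orthogonal_transformation_dist[OF T])
  show inv: "distr flag_law borel R = flag_law"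
    using distr_flag_law[OF T] R by simp
  have "distr (distr flag_law borel prod.swap) borel R = distr flag_law borel (R \<circ> prod.swap)"
    using Tb[OF T] swap by (subst distr_distr) (simp_all add: R flag_law_def)
  also have "R \<circ> prod.swap = prod.swap \<circ> R" by (auto simp: R)
  also have "distr flag_law borel (prod.swap \<circ> R) = distr (distr flag_law borel R) borel prod.swap"
    using Tb[OF T] swap by (subst distr_distr) (simp_all add: R flag_law_def)
  finally show "distr (distr flag_law borel prod.swap) borel R = distr flag_law borel prod.swap"
    by (simp add: inv)
next
  fix x y :: "'a \<times> 'a" assume xy: "x \<in> flags" "y \<in> flags"
  then obtain T where "orthogonal_transformation T" "T (fst x) = fst y" "T (snd x) = snd y"
    unfolding flags_def using orthogonal_transformation_frame by blast
  then show "\<exists>R\<in>{map_prod T T | T. orthogonal_transformation T}. R x = y"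
    by (intro bexI[of _ "map_prod T T"]) (auto simp: map_prod_def split_beta)
qed

text \<open>Self-adjointness in general form: for a product of a function of the first entry and one
  of the second, one side integrates the first against the Funk transform of the second, and the
  other side has the roles exchanged.\<close>

lemma integral_flag_swap:
  fixes H :: "'a::euclidean_space \<times> 'a \<Rightarrow> real"
  assumes d: "DIM('a) \<ge> 2" and H: "H \<in> borel_measurable borel"
    and bound: "\<And>a b. norm a \<le> 1 \<Longrightarrow> norm b \<le> 1 \<Longrightarrow> \<bar>H (a, b)\<bar> \<le> K"
  shows "(LINT y|unit_ball_measure. LINT x|unit_ball_measure. H (sgn y, perp_dir y x)) =
    (LINT y|unit_ball_measure. LINT x|unit_ball_measure. H (perp_dir y x, sgn y))"
proof -
  have 1: "(LINT p|flag_law. G p) =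
      (LINT y|unit_ball_measure. LINT x|unit_ball_measure. G (sgn y, perp_dir y x))"
    if G: "G \<in> borel_measurable borel" and b: "\<And>a b. norm a \<le> 1 \<Longrightarrow> norm b \<le> 1 \<Longrightarrow> \<bar>G (a, b)\<bar> \<le> K"
    for G :: "'a \<times> 'a \<Rightarrow> real"
  proof -
    have m: "(\<lambda>p. G (flag p)) \<in> borel_measurable (unit_ball_measure \<Otimes>\<^sub>M unit_ball_measure)"
      using measurable_compose[OF flag_borel G]
      by (simp add: measurable_cong_sets[OF sets_unit_ball_pair refl])
    have "integrable (unit_ball_measure \<Otimes>\<^sub>M unit_ball_measure) (\<lambda>p. G (flag p))"
      using m by (rule unit_ball_pair.P.integrable_const_bound[rotated, of _ K])
        (auto simp: flag_def norm_sgn norm_perp_dir_le intro!: b AE_I2)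
    from unit_ball_pair.integral_fst'[OF this]
    have "(LINT p|(unit_ball_measure \<Otimes>\<^sub>M unit_ball_measure). G (flag p)) =
      (LINT y|unit_ball_measure. LINT x|unit_ball_measure. G (sgn y, perp_dir y x))"
      by (simp add: flag_def)
    then show ?thesis
      unfolding flag_law_def using G flag_borel
      by (subst integral_distr) (simp_all add: measurable_cong_sets[OF sets_unit_ball_pair refl])
  qed
  have swap: "prod.swap \<in> borel_measurable (borel :: ('a \<times> 'a) measure)"
    unfolding prod.swap_def by (intro borel_measurable_continuous_onI continuous_intros)
  have "(LINT p|flag_law. H p) = (LINT p|distr flag_law borel prod.swap. H p)"
    by (simp add: distr_flag_law_swap[OF d])
  also have "\<dots> = (LINT p|flag_law. H (prod.swap p))"
    using H swap by (subst integral_distr) (simp_all add: flag_law_def)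
  finally show ?thesis
    using 1[OF H bound] 1[of "\<lambda>p. H (prod.swap p)"] measurable_compose[OF swap H] bound by simp
qed

section \<open>Moments of even powers of a linear form\<close>

lemma integrable_unit_ball_bounded:
  fixes g :: "'a::euclidean_space \<Rightarrow> real"
  assumes "g \<in> borel_measurable borel" "\<And>x. \<bar>g x\<bar> \<le> K"
  shows "integrable unit_ball_measure g"
  using assms by (intro unit_ball.integrable_const_bound[of _ K]) auto

text \<open>The direction lies in the complement of \<open>\<omega>\<close>, so only the projection
  of \<open>e\<close> counts. Writing it as \<open>r\<close> times a unit vector \<open>u\<close>
  orthogonal to \<open>\<omega>\<close> extracts \<open>r ^ (2 * k)\<close>, and by transitivity the
  remaining moment \<open>m\<close> does not depend on the orthonormal pair.\<close>

lemma integral_perp_dir_moment: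
  assumes d: "DIM('a::euclidean_space) \<ge> 2"
  obtains m where "m > 0" "\<And>\<omega> e :: 'a. norm \<omega> = 1 \<Longrightarrow> norm e = 1 \<Longrightarrow>
    (LINT x|unit_ball_measure. (perp_dir \<omega> x \<bullet> e) ^ (2 * k)) = m * (1 - (\<omega> \<bullet> e)\<^sup>2) ^ k"
proof -
  let ?I = "\<lambda>\<omega> e :: 'a. LINT x|unit_ball_measure. (perp_dir \<omega> x \<bullet> e) ^ (2 * k)"
  have ex: "\<exists>u. norm u = 1 \<and> u \<bullet> \<omega> = 0" for \<omega> :: 'a
  proof -
    obtain x where "perp_dir \<omega> x \<in> unit_sphere \<inter> perp \<omega>"
      using eventually_happens'[OF _ AE_perp_dir[OF d, of \<omega>]] unit_ball.ae_filter_bot by blast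
    then show ?thesis by (auto simp: perp_def)
  qed
  obtain \<omega>0 :: 'a where \<omega>0: "norm \<omega>0 = 1" using ex by blast
  obtain e0 where e0: "norm e0 = 1" "e0 \<bullet> \<omega>0 = 0" using ex by blast
  have inv: "?I \<omega> u = ?I \<omega>0 e0" if wu: "norm \<omega> = 1" "norm u = 1" "u \<bullet> \<omega> = 0" for \<omega> u
  proof -
    obtain T where T: "orthogonal_transformation T" "T \<omega> = \<omega>0" "T u = e0"
      using orthogonal_transformation_frame[of \<omega> u \<omega>0 e0] wu \<omega>0 e0 by (metis inner_commute)
    note [measurable] = orthogonal_transformation_borel[OF T(1)]
    have "perp_dir \<omega> x \<bullet> u = perp_dir \<omega>0 (T x) \<bullet> e0" for x
      using orthogonal_transformation_inner[OF T(1), of "perp_dir \<omega> x" u] T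
      by (simp add: orthogonal_transformation_perp_dir)
    then have "?I \<omega> u = (LINT x|unit_ball_measure. (perp_dir \<omega>0 (T x) \<bullet> e0) ^ (2 * k))" by simp
    also have "\<dots> = (LINT x|distr unit_ball_measure borel T. (perp_dir \<omega>0 x \<bullet> e0) ^ (2 * k))"
      by (subst integral_distr) auto
    finally show ?thesis by (simp add: unit_ball_measure_orthogonal[OF T(1)])
  qed
  show ?thesis
  proof
    have le: "\<bar>(perp_dir \<omega>0 x \<bullet> e0) ^ (2 * k)\<bar> \<le> 1" for x
    proof -
      have "\<bar>perp_dir \<omega>0 x \<bullet> e0\<bar> \<le> 1"
        using Cauchy_Schwarz_ineq2[of "perp_dir \<omega>0 x" e0] norm_perp_dir_le[of \<omega>0 x] e0 by simp
      then show ?thesis by (simp add: power_abs power_le_one)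
    qed
    have int: "integrable unit_ball_measure (\<lambda>x. (perp_dir \<omega>0 x \<bullet> e0) ^ (2 * k))"
      using le by (intro integrable_unit_ball_bounded) measurable
    \<comment> \<open>The integrand is nonnegative, so a zero integral would make it vanish almost
      everywhere, forcing almost every \<open>x\<close> into the null hyperplane orthogonal to
      \<open>e0\<close>.\<close>
    have "?I \<omega>0 e0 \<noteq> 0"
    proof
      assume "?I \<omega>0 e0 = 0"
      then have "AE x in unit_ball_measure. (perp_dir \<omega>0 x \<bullet> e0) ^ (2 * k) = 0"
        using int by (subst (asm) integral_nonneg_eq_0_iff_AE) auto
      moreover have "AE x in unit_ball_measure. x \<notin> {x. e0 \<bullet> x = 0}"
        using e0 by (intro AE_unit_ball_negligible negligible_hyperplane) auto
      ultimately have "AE x in (unit_ball_measure :: 'a measure). False"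
        using AE_unit_ball_proj_perp_nonzero[OF d, of \<omega>0]
      proof eventually_elim
        fix x assume 1: "(perp_dir \<omega>0 x \<bullet> e0) ^ (2 * k) = 0" "x \<notin> {x. e0 \<bullet> x = 0}" "proj_perp \<omega>0 x \<noteq> 0"
        then have "proj_perp \<omega>0 x \<bullet> e0 = 0" by (simp add: perp_dir_def sgn_div_norm)
        moreover have "proj_perp \<omega>0 x \<bullet> e0 = x \<bullet> e0"
          using inner_proj_perp[of e0 \<omega>0 x] e0 by (simp add: perp_def inner_commute)
        ultimately show False using 1 by (simp add: inner_commute)
      qed
      then show False by simp
    qed
    moreover have "?I \<omega>0 e0 \<ge> 0" by (intro integral_nonneg_AE AE_I2) simp
    ultimately show "?I \<omega>0 e0 > 0" by linarith
    fix \<omega> e :: 'a assume \<omega>: "norm \<omega> = 1" and e: "norm e = 1"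
    define r where "r = norm (proj_perp \<omega> e)"
    \<comment> \<open>If the projection of \<open>e\<close> vanishes, any unit vector orthogonal to
      \<open>\<omega>\<close> serves as \<open>u\<close>.\<close>
    obtain u where u: "norm u = 1" "u \<bullet> \<omega> = 0" "proj_perp \<omega> e = r *\<^sub>R u"
    proof (cases "r = 0")
      case True
      then show ?thesis using ex[of \<omega>] that by (auto simp: r_def)
    next
      case False
      have "perp_dir \<omega> e \<in> unit_sphere \<inter> perp \<omega>"
        using False by (intro perp_dir_in_sphere) (simp add: r_def)
      moreover have "proj_perp \<omega> e = r *\<^sub>R perp_dir \<omega> e"
        using False by (simp add: r_def perp_dir_def sgn_div_norm)
      ultimately show ?thesis using that by (auto simp: perp_def)
    qed
    have "perp_dir \<omega> x \<bullet> e = r * (perp_dir \<omega> x \<bullet> u)" for x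
      using inner_proj_perp[OF perp_dir_in_perp, of \<omega> x e] u(3) by simp
    then have "?I \<omega> e = r ^ (2 * k) * ?I \<omega> u" by (simp add: power_mult_distrib)
    also have "r ^ (2 * k) = (1 - (\<omega> \<bullet> e)\<^sup>2) ^ k"
    proof -
      have "\<omega> \<bullet> \<omega> = 1" "e \<bullet> e = 1" using \<omega> e by (simp_all add: norm_eq_1)
      then have "r\<^sup>2 = 1 - (\<omega> \<bullet> e)\<^sup>2"
        unfolding r_def power2_norm_eq_inner proj_perp_def
        by (simp add: inner_diff_left inner_diff_right inner_commute power2_eq_square)
      then show ?thesis by (simp add: power_mult)
    qed
    finally show "?I \<omega> e = ?I \<omega>0 e0 * (1 - (\<omega> \<bullet> e)\<^sup>2) ^ k"
      using inv[OF \<omega> u(1,2)] by simp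
  qed
qed

lemma abs_sgn_inner_le: "norm e = 1 \<Longrightarrow> \<bar>sgn y \<bullet> e\<bar> \<le> (1::real)"
  using Cauchy_Schwarz_ineq2[of "sgn y" e] by (auto simp: norm_sgn split: if_splits)

lemma Funk_zero_imp_moment_zero:
  fixes f :: "'a::euclidean_space \<Rightarrow> real"
  assumes d: "DIM('a) \<ge> 2" and f: "f \<in> borel_measurable borel" and bound: "\<And>x. \<bar>f x\<bar> \<le> K"
    and zero: "\<And>\<omega>. norm \<omega> = 1 \<Longrightarrow> (LINT x|unit_ball_measure. f (perp_dir \<omega> x)) = 0"
    and e: "norm e = 1"
  shows "(LINT y|unit_ball_measure. (sgn y \<bullet> e) ^ (2 * k) * f (sgn y)) = 0"
proof -
  note [measurable] = f
  have 0: "(LINT y|unit_ball_measure. (1 - (sgn y \<bullet> e)\<^sup>2) ^ j * f (sgn y)) = 0" for j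
  proof -
    obtain m where m: "m > 0" "\<And>\<omega> e :: 'a. norm \<omega> = 1 \<Longrightarrow> norm e = 1 \<Longrightarrow>
      (LINT x|unit_ball_measure. (perp_dir \<omega> x \<bullet> e) ^ (2 * j)) = m * (1 - (\<omega> \<bullet> e)\<^sup>2) ^ j"
      using integral_perp_dir_moment[OF d] by blast
    \<comment> \<open>In one order the inner integral contains the Funk transform of
      \<open>f\<close>, which is zero; in the other it is the moment of the power, leaving
      \<open>m * (1 - (sgn y \<bullet> e)\<^sup>2) ^ j\<close> as a weight on
      \<open>f\<close>.\<close>
    let ?H = "\<lambda>p. (fst p \<bullet> e) ^ (2 * j) * f (snd p)"
    have K: "K \<ge> 0" using bound[of 0] by linarith
    have "\<bar>?H (a, b)\<bar> \<le> K" if "norm a \<le> 1" "norm b \<le> 1" for a b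
    proof -
      have "\<bar>a \<bullet> e\<bar> \<le> 1" using Cauchy_Schwarz_ineq2[of a e] that e by simp
      then have "\<bar>(a \<bullet> e) ^ (2 * j)\<bar> \<le> 1" by (simp add: power_abs power_le_one)
      then show ?thesis using mult_mono[OF _ bound[of b], of "\<bar>(a \<bullet> e) ^ (2 * j)\<bar>" 1] by (simp add: abs_mult)
    qed
    moreover have "?H \<in> borel_measurable borel"
      unfolding borel_prod[symmetric] by measurable
    ultimately have "(LINT y|unit_ball_measure. LINT x|unit_ball_measure. ?H (sgn y, perp_dir y x)) =
      (LINT y|unit_ball_measure. LINT x|unit_ball_measure. ?H (perp_dir y x, sgn y))"
      using integral_flag_swap[OF d, of ?H K] by blast
    moreover have "(LINT y|unit_ball_measure. LINT x|unit_ball_measure. ?H (sgn y, perp_dir y x)) = 0"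
    proof (rule integral_eq_zero_AE, use AE_unit_ball_nonzero[OF d] in eventually_elim)
      fix y :: 'a assume "y \<noteq> 0"
      then show "(LINT x|unit_ball_measure. ?H (sgn y, perp_dir y x)) = 0"
        using zero[of "sgn y"] by (simp add: norm_sgn perp_dir_sgn)
    qed
    moreover have "(LINT y|unit_ball_measure. LINT x|unit_ball_measure. ?H (perp_dir y x, sgn y))
      = (LINT y|unit_ball_measure. m * ((1 - (sgn y \<bullet> e)\<^sup>2) ^ j * f (sgn y)))"
    proof (rule integral_cong_AE)
      show "AE y in unit_ball_measure. (LINT x|unit_ball_measure. ?H (perp_dir y x, sgn y))
          = m * ((1 - (sgn y \<bullet> e)\<^sup>2) ^ j * f (sgn y))"
        using AE_unit_ball_nonzero[OF d]
      proof eventually_elim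
        fix y :: 'a assume "y \<noteq> 0"
        then show "(LINT x|unit_ball_measure. ?H (perp_dir y x, sgn y))
            = m * ((1 - (sgn y \<bullet> e)\<^sup>2) ^ j * f (sgn y))"
          using m(2)[of "sgn y" e] e by (simp add: norm_sgn perp_dir_sgn)
      qed
      show "(\<lambda>y. LINT x|unit_ball_measure. ?H (perp_dir y x, sgn y)) \<in> borel_measurable unit_ball_measure"
        by (intro unit_ball.borel_measurable_lebesgue_integral)
           (simp add: split_beta' measurable_cong_sets[OF sets_unit_ball_pair refl], measurable)
    qed measurable
    ultimately show ?thesis using m(1) by simp
  qed
  have int: "integrable unit_ball_measure (\<lambda>y. (1 - (sgn y \<bullet> e)\<^sup>2) ^ j * f (sgn y))" for j
  proof (rule integrable_unit_ball_bounded[of _ K])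
    fix y
    have "(sgn y \<bullet> e)\<^sup>2 \<le> 1" using abs_sgn_inner_le[OF e] by (simp add: abs_square_le_1)
    then have "\<bar>(1 - (sgn y \<bullet> e)\<^sup>2) ^ j\<bar> \<le> 1" by (simp add: power_abs power_le_one)
    then show "\<bar>(1 - (sgn y \<bullet> e)\<^sup>2) ^ j * f (sgn y)\<bar> \<le> K"
      using mult_mono[OF _ bound[of "sgn y"], of "\<bar>(1 - (sgn y \<bullet> e)\<^sup>2) ^ j\<bar>" 1] by (simp add: abs_mult)
  qed measurable
  \<comment> \<open>With \<open>t = sgn y \<bullet> e\<close>, the binomial theorem is applied to
    \<open>t\<^sup>2 = 1 - (1 - t\<^sup>2)\<close>, expressing the even power through the weights
    already treated.\<close>
  have "(sgn y \<bullet> e) ^ (2 * k) * f (sgn y) =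
      (\<Sum>j\<le>k. (real (k choose j) * (-1) ^ j) * ((1 - (sgn y \<bullet> e)\<^sup>2) ^ j * f (sgn y)))" for y
  proof -
    have "(sgn y \<bullet> e) ^ (2 * k) = (- (1 - (sgn y \<bullet> e)\<^sup>2) + 1) ^ k" by (simp add: power_mult)
    also have "\<dots> = (\<Sum>j\<le>k. real (k choose j) * (- (1 - (sgn y \<bullet> e)\<^sup>2)) ^ j)"
      by (subst binomial_ring) simp
    also have "\<dots> = (\<Sum>j\<le>k. (real (k choose j) * (-1) ^ j) * (1 - (sgn y \<bullet> e)\<^sup>2) ^ j)"
      by (intro sum.cong refl) (subst power_minus, simp)
    finally show ?thesis by (simp add: sum_distrib_right mult.assoc)
  qed
  then have "(LINT y|unit_ball_measure. (sgn y \<bullet> e) ^ (2 * k) * f (sgn y)) =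
     (\<Sum>j\<le>k. LINT y|unit_ball_measure. (real (k choose j) * (-1) ^ j) * ((1 - (sgn y \<bullet> e)\<^sup>2) ^ j * f (sgn y)))"
    using int by (simp add: Bochner_Integration.integral_sum)
  also have "\<dots> = 0" using 0 by (intro sum.neutral ballI) simp
  finally show ?thesis .
qed

subsection \<open>Injectivity of the Funk transform\<close>

text \<open>If \<open>f e > 0\<close>, then \<open>f\<close> is positive where \<open>\<bar>x \<bullet> e\<bar> > a\<close>, and for some \<open>b > a\<close> that region contributes
  at least a multiple of \<open>b ^ (2 * k)\<close>, which outgrows the \<open>K * a ^ (2 * k)\<close> of the rest.\<close>

lemma moment_zero_imp_nonpos:
  fixes f :: "'a::euclidean_space \<Rightarrow> real"
  assumes d: "DIM('a) \<ge> 2" and f: "f \<in> borel_measurable borel" and bound: "\<And>x. \<bar>f x\<bar> \<le> K"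
    and even: "\<And>x. norm x = 1 \<Longrightarrow> f (- x) = f x"
    and cont: "continuous_on unit_sphere f"
    and e: "norm e = 1"
    and zero: "\<And>k. (LINT y|unit_ball_measure. (sgn y \<bullet> e) ^ (2 * k) * f (sgn y)) = 0"
  shows "f e \<le> 0"
proof (rule ccontr)
  assume "\<not> f e \<le> 0"
  \<comment> \<open>Half of \<open>f e\<close>, so that a deviation of less than \<open>c\<close>
    from \<open>f e\<close> leaves a value above \<open>c\<close>.\<close>
  define c where "c = f e / 2"
  have c: "c > 0" using \<open>\<not> f e \<le> 0\<close> by (simp add: c_def)
  note [measurable] = f
  have K: "K \<ge> 0" using bound[of 0] by linarith
  obtain \<delta>' where \<delta>': "\<delta>' > 0" "\<And>x. norm x = 1 \<Longrightarrow> dist x e < \<delta>' \<Longrightarrow> dist (f x) (f e) < c"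
  proof -
    have "e \<in> unit_sphere" using e by simp
    with cont c obtain d' where "d' > 0" "\<forall>x\<in>unit_sphere. dist x e < d' \<longrightarrow> dist (f x) (f e) < c"
      unfolding continuous_on_iff by meson
    then show ?thesis using that by simp
  qed
  define \<delta> where "\<delta> = min \<delta>' 1"
  have \<delta>: "0 < \<delta>" "\<delta> \<le> 1" "\<delta> \<le> \<delta>'" using \<delta>' by (auto simp: \<delta>_def)
  \<comment> \<open>For unit vectors
    \<open>(norm (x - e))\<^sup>2 = 2 - 2 * (x \<bullet> e)\<close>, so
    \<open>x \<bullet> e > a\<close> says exactly that \<open>x\<close> is within
    \<open>\<delta>\<close> of \<open>e\<close>. The cap \<open>\<delta> \<le> 1\<close> keeps
    \<open>a\<close> positive, and \<open>b\<close> is the midpoint of \<open>a\<close> and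
    1.\<close>
  define a where "a = 1 - \<delta>\<^sup>2 / 2"
  define b where "b = (1 + a) / 2"
  have "\<delta>\<^sup>2 \<le> 1" using \<delta> by (simp add: power_le_one)
  moreover have "\<delta>\<^sup>2 > 0" using \<delta> by simp
  ultimately have a: "0 < a" "a < 1" by (auto simp: a_def)
  then have b: "a < b" "b < 1" by (auto simp: b_def)
  have pos: "f x \<ge> c" if x: "norm x = 1" "x \<bullet> e > a" for x
  proof -
    have "x \<bullet> x = 1" "e \<bullet> e = 1" using x e by (simp_all add: norm_eq_1)
    then have "(norm (x - e))\<^sup>2 = 2 - 2 * (x \<bullet> e)"
      by (simp add: power2_norm_eq_inner inner_diff_left inner_diff_right inner_commute)
    also have "\<dots> < \<delta>\<^sup>2" using x(2) by (simp add: a_def field_simps)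
    finally have "norm (x - e) < \<delta>" using \<delta> by (simp add: power_less_imp_less_base)
    then have "dist (f x) (f e) < c" using \<delta>'(2)[OF x(1)] \<delta> by (simp add: dist_norm)
    then show ?thesis unfolding dist_real_def c_def abs_less_iff by linarith
  qed
  have pos': "f x \<ge> c" if x: "norm x = 1" "\<bar>x \<bullet> e\<bar> > a" for x
    using pos[of x] pos[of "- x"] even[OF x(1)] x by (cases "x \<bullet> e \<ge> 0") auto
  define U where "U = {y. \<bar>sgn y \<bullet> e\<bar> > b}"
  have U [measurable]: "U \<in> sets borel" unfolding U_def by measurable
  define p where "p = measure unit_ball_measure U"
  have "p > 0"
  proof -
    \<comment> \<open>An open piece of the cone over the cap around \<open>e\<close>; it contains
      \<open>e / 2\<close>, so it is not negligible and gives \<open>U\<close> positive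
      mass.\<close>
    define V where "V = {y. y \<bullet> e > b * norm y} \<inter> ball 0 1"
    have "open V" unfolding V_def by (intro open_Int open_Collect_less continuous_intros) auto
    moreover have "e /\<^sub>R 2 \<in> V" using e b by (simp add: V_def dot_square_norm)
    ultimately have "\<not> negligible V" using open_not_negligible by blast
    have "V \<subseteq> ball 0 1 \<inter> U"
    proof
      fix y assume y: "y \<in> V"
      then have "y \<noteq> 0" by (auto simp: V_def)
      then have "sgn y \<bullet> e > b" using y by (simp add: V_def sgn_div_norm field_simps)
      then show "y \<in> ball 0 1 \<inter> U" using y by (simp add: V_def U_def)
    qed
    then have "\<not> negligible (ball 0 1 \<inter> U)" using \<open>\<not> negligible V\<close> negligible_subset by blast
    moreover have "ball 0 1 \<inter> U \<in> sets lborel" using U by simp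
    ultimately have "emeasure lborel (ball 0 1 \<inter> U) \<noteq> 0"
      by (metis negligible_iff_null_sets null_setsI null_sets_completionI)
    then have "emeasure unit_ball_measure U \<noteq> 0"
      using U emeasure_unit_ball[where 'a = 'a] by (simp add: unit_ball_measure_def)
    then show ?thesis
      by (simp add: p_def unit_ball.emeasure_eq_measure zero_less_measure_iff)
  qed
  \<comment> \<open>The integrand is at least \<open>c * b ^ (2 * k)\<close> on \<open>U\<close>,
    nonnegative on the band between \<open>a\<close> and \<open>b\<close>, and at least
    \<open>- K * a ^ (2 * k)\<close> on the rest; its integral is zero.\<close>
  have main: "c * p * b ^ (2 * k) \<le> K * a ^ (2 * k)" for k
  proof -
    have int: "integrable unit_ball_measure (\<lambda>y. (sgn y \<bullet> e) ^ (2 * k) * f (sgn y))"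
    proof (rule integrable_unit_ball_bounded[of _ K])
      fix y
      have "\<bar>(sgn y \<bullet> e) ^ (2 * k)\<bar> \<le> 1" using abs_sgn_inner_le[OF e] by (simp add: power_abs power_le_one)
      then show "\<bar>(sgn y \<bullet> e) ^ (2 * k) * f (sgn y)\<bar> \<le> K"
        using mult_mono[OF _ bound[of "sgn y"], of "\<bar>(sgn y \<bullet> e) ^ (2 * k)\<bar>" 1] by (simp add: abs_mult)
    qed measurable
    have intU: "integrable unit_ball_measure (\<lambda>y. c * b ^ (2 * k) * indicator U y - K * a ^ (2 * k))"
      using U by (intro Bochner_Integration.integrable_diff integrable_mult_right) (auto simp: less_top[symmetric])
    have "(LINT y|unit_ball_measure. c * b ^ (2 * k) * indicator U y - K * a ^ (2 * k))
        \<le> (LINT y|unit_ball_measure. (sgn y \<bullet> e) ^ (2 * k) * f (sgn y))"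
    proof (rule integral_mono_AE[OF intU int], use AE_unit_ball_nonzero[OF d] in eventually_elim)
      fix y :: 'a assume "y \<noteq> 0"
      then have n: "norm (sgn y) = 1" by (simp add: norm_sgn)
      define t where "t = sgn y \<bullet> e"
      have even_pow: "t ^ (2 * k) = \<bar>t\<bar> ^ (2 * k)" by (simp add: power_mult)
      consider "\<bar>t\<bar> > b" | "a < \<bar>t\<bar>" "\<bar>t\<bar> \<le> b" | "\<bar>t\<bar> \<le> a" by linarith
      then have "c * b ^ (2 * k) * indicator U y - K * a ^ (2 * k) \<le> t ^ (2 * k) * f (sgn y)"
      proof cases
        case 1
        then have "b ^ (2 * k) * c \<le> t ^ (2 * k) * f (sgn y)"
          unfolding even_pow using pos'[OF n] a b c by (intro mult_mono power_mono) (auto simp: t_def)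
        moreover have "K * a ^ (2 * k) \<ge> 0" using K a by simp
        moreover have "indicator U y = (1 :: real)" using 1 by (simp add: U_def t_def)
        ultimately show ?thesis by (simp add: mult.commute)
      next
        case 2
        then have "0 \<le> t ^ (2 * k) * f (sgn y)"
          unfolding even_pow using pos'[OF n] c by (auto simp: t_def intro!: mult_nonneg_nonneg)
        moreover have "K * a ^ (2 * k) \<ge> 0" using K a by simp
        moreover have "indicator U y = (0 :: real)" using 2 by (simp add: U_def t_def)
        ultimately show ?thesis by simp
      next
        case 3
        have "\<bar>t ^ (2 * k) * f (sgn y)\<bar> \<le> a ^ (2 * k) * K"
          unfolding abs_mult power_abs using 3 bound a by (intro mult_mono power_mono) auto
        moreover have "indicator U y = (0 :: real)" using 3 b by (simp add: U_def t_def)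
        ultimately show ?thesis by (simp add: mult.commute)
      qed
      then show "c * b ^ (2 * k) * indicator U y - K * a ^ (2 * k) \<le> (sgn y \<bullet> e) ^ (2 * k) * f (sgn y)"
        by (simp add: t_def)
    qed
    moreover have "(LINT y|unit_ball_measure. c * b ^ (2 * k) * indicator U y - K * a ^ (2 * k))
        = c * b ^ (2 * k) * p - K * a ^ (2 * k)"
      using U by (subst Bochner_Integration.integral_diff)
        (auto simp: p_def less_top[symmetric] unit_ball.prob_space[simplified])
    ultimately show ?thesis using zero[of k] by (simp add: algebra_simps)
  qed
  \<comment> \<open>Division by \<open>b ^ (2 * k)\<close> leaves a right side tending to 0, since
    \<open>a / b < 1\<close>.\<close>
  have "(\<lambda>k. K * (a / b) ^ (2 * k)) \<longlonglongrightarrow> K * 0"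
  proof (rule tendsto_mult_left)
    have "(\<lambda>k. ((a / b)\<^sup>2) ^ k) \<longlonglongrightarrow> 0"
      using a b by (intro LIMSEQ_realpow_zero) (auto simp: power_less_one_iff abs_square_less_1)
    then show "(\<lambda>k. (a / b) ^ (2 * k)) \<longlonglongrightarrow> 0" by (simp add: power_mult)
  qed
  moreover have "c * p \<le> K * (a / b) ^ (2 * k)" for k
    using main[of k] a b by (simp add: power_divide field_simps)
  ultimately have "c * p \<le> K * 0" by (intro LIMSEQ_le_const) auto
  then show False using c \<open>p > 0\<close> by (simp add: mult_le_0_iff)
qed

text \<open>The one-sided bound is applied to \<open>f\<close> and to \<open>- f\<close>, both of
  which have zero Funk transform.\<close>

lemma Funk_zero_imp_zero_real:
  fixes f :: "'a::euclidean_space \<Rightarrow> real"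
  assumes d: "DIM('a) \<ge> 2" and cont: "continuous_on unit_sphere f"
    and even: "\<And>x. norm x = 1 \<Longrightarrow> f (- x) = f x"
    and zero: "\<And>\<omega>. norm \<omega> = 1 \<Longrightarrow> (LINT \<theta>|subsphere_measure \<omega>. f \<theta>) = 0"
    and e: "norm e = 1"
  shows "f e = 0"
proof -
  have le: "g e \<le> 0" if cont: "continuous_on unit_sphere g"
    and even: "\<And>x. norm x = 1 \<Longrightarrow> g (- x) = g x"
    and zero: "\<And>\<omega>. norm \<omega> = 1 \<Longrightarrow> (LINT \<theta>|subsphere_measure \<omega>. g \<theta>) = 0" for g :: "'a \<Rightarrow> real"
  proof -
    \<comment> \<open>Extension by zero gives a bounded Borel function on the whole space;
      \<open>perp_dir\<close> and \<open>sgn\<close> leave the sphere on a null set.\<close>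
    define h where "h x = (indicator unit_sphere x *\<^sub>R g x :: real)" for x
    have hS: "h x = g x" if "norm x = 1" for x using that by (simp add: h_def)
    have h: "h \<in> borel_measurable borel"
      unfolding h_def by (rule borel_measurable_continuous_on_indicator) (use cont in auto)
    obtain K where K: "\<And>x. x \<in> unit_sphere \<Longrightarrow> \<bar>g x\<bar> \<le> K"
      using compact_imp_bounded[OF compact_continuous_image[OF cont compact_sphere]]
      unfolding bounded_iff real_norm_def by blast
    have bound: "\<bar>h x\<bar> \<le> \<bar>K\<bar>" for x using K[of x] by (auto simp: h_def indicator_def)
    have hz: "(LINT x|unit_ball_measure. h (perp_dir \<omega> x)) = 0" if w: "norm \<omega> = 1" for \<omega>
    proof -
      have "(LINT x|unit_ball_measure. h (perp_dir \<omega> x)) = (LINT \<theta>|subsphere_measure \<omega>. h \<theta>)"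
        by (rule integral_subsphere_measure[OF d w h, symmetric])
      also have "\<dots> = (LINT \<theta>|subsphere_measure \<omega>. g \<theta>)"
        by (intro Bochner_Integration.integral_cong refl)
           (auto simp: space_subsphere_measure[OF d w] hS)
      finally show ?thesis using zero[OF w] by simp
    qed
    have "continuous_on unit_sphere h"
      using cont by (rule continuous_on_eq) (auto simp: hS)
    then have "h e \<le> 0"
      using Funk_zero_imp_moment_zero[OF d h bound hz e] even e
      by (intro moment_zero_imp_nonpos[OF d h bound]) (auto simp: hS)
    then show ?thesis using e by (simp add: hS)
  qed
  show ?thesis
  proof (rule antisym)
    show "f e \<le> 0" using cont even zero by (rule le)
    have "- f e \<le> 0"
      by (rule le[of "\<lambda>x. - f x"]) (use cont even zero in \<open>simp_all add: continuous_on_minus\<close>)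
    then show "0 \<le> f e" by simp
  qed
qed

lemma integrable_subsphere_continuous:
  fixes f :: "'a::euclidean_space \<Rightarrow> complex"
  assumes d: "DIM('a) \<ge> 2" and w: "norm \<omega> = 1" and cont: "continuous_on unit_sphere f"
  shows "integrable (subsphere_measure \<omega>) f"
proof -
  interpret prob_space "subsphere_measure \<omega>"
    unfolding subsphere_measure_eq[OF d w] by (rule restrict_space_perp_dir_law(2)[OF d])
  obtain K where K: "\<And>x. x \<in> unit_sphere \<Longrightarrow> norm (f x) \<le> K"
    using compact_imp_bounded[OF compact_continuous_image[OF cont compact_sphere]]
    unfolding bounded_iff by blast
  have "sets (subsphere_measure \<omega>) = sets (restrict_space borel (unit_sphere \<inter> perp \<omega>))"
    unfolding subsphere_measure_eq[OF d w] by (rule restrict_space_perp_dir_law(1)[OF d])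
  moreover have "f \<in> borel_measurable (restrict_space borel (unit_sphere \<inter> perp \<omega>))"
    by (rule borel_measurable_continuous_on_restrict) (rule continuous_on_subset[OF cont], simp)
  ultimately have "f \<in> borel_measurable (subsphere_measure \<omega>)"
    by (simp cong: measurable_cong_sets)
  then show ?thesis
    by (rule integrable_const_bound[rotated, of _ K])
       (auto simp: space_subsphere_measure[OF d w] intro!: AE_I2 K)
qed

section \<open>Smoothness by local extensions and its behaviour under linear maps\<close>

lemma smooth_on_sub_continuous:
  assumes "smooth_on_sub M f" shows "continuous_on M f"
  unfolding continuous_on_eq_continuous_within
proof
  fix p assume "p \<in> M"
  then obtain U g where U: "open U" "p \<in> U" "\<forall>k. C_k_on k U g" "\<forall>x\<in>U \<inter> M. g x = f x"
    using assms unfolding smooth_on_sub_def by blast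
  have "continuous_on U g" using spec[OF U(3), of 0] by simp
  then have "isCont g p" using U continuous_on_eq_continuous_at[OF \<open>open U\<close>] by blast
  then have "continuous (at p within M) g" by (rule continuous_at_imp_continuous_at_within)
  moreover have "\<forall>\<^sub>F x in at p within M. g x = f x"
    using U by (auto simp: eventually_at_topological)
  ultimately show "continuous (at p within M) f"
    using U \<open>p \<in> M\<close> by (auto simp: continuous_within intro: Lim_transform_eventually)
qed

text \<open>On an open set equal functions have equal Frechet derivatives, so agreement passes to
  each directional derivative and the induction on \<open>k\<close> proceeds.\<close>

lemma C_k_on_cong:
  assumes "open U" "\<And>x. x \<in> U \<Longrightarrow> f x = g x" "C_k_on k U f"
  shows "C_k_on k U g"
  using assms(2,3)
proof (induction k arbitrary: f g)
  case 0
  then show ?case by (auto intro: continuous_on_eq)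
next
  case (Suc k)
  have der: "(g has_derivative frechet_derivative f (at x)) (at x)" if "x \<in> U" for x
  proof (rule has_derivative_transform_within_open[OF _ \<open>open U\<close> that])
    show "(f has_derivative frechet_derivative f (at x)) (at x)"
      using Suc.prems(2) that by (simp add: frechet_derivative_works[symmetric])
  qed (use Suc.prems in auto)
  have eq: "frechet_derivative f (at x) = frechet_derivative g (at x)" if "x \<in> U" for x
    by (rule frechet_derivative_at[OF der[OF that]])
  have "C_k_on k U (\<lambda>x. frechet_derivative g (at x) v)" for v
  proof (rule Suc.IH)
    show "C_k_on k U (\<lambda>x. frechet_derivative f (at x) v)" using Suc.prems(2) by simp
  qed (simp add: eq)
  then show ?case using der by (auto simp: differentiable_def)
qed

text \<open>By the chain rule the derivative in direction \<open>v\<close> is again a composite with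
  \<open>L\<close>, namely of the derivative of \<open>g\<close> in the fixed direction
  \<open>L v\<close>, so the induction closes. This identity holds only on the preimage of
  \<open>U\<close>, whence the congruence lemma.\<close>

lemma C_k_on_linear_compose:
  fixes L :: "'a::euclidean_space \<Rightarrow> 'b::euclidean_space"
  assumes L: "bounded_linear L" and U: "open U" and "C_k_on k U g"
  shows "C_k_on k (L -` U) (\<lambda>x. g (L x))"
  using assms(3)
proof (induction k arbitrary: g)
  case 0
  have "continuous_on (L -` U) L" by (rule linear_continuous_on[OF L])
  then show ?case using 0 by (auto intro: continuous_on_compose2)
next
  case (Suc k)
  have "open (L -` U)"
    using U by (rule open_vimage) (rule linear_continuous_on[OF L])
  have der: "((\<lambda>x. g (L x)) has_derivative (\<lambda>v. frechet_derivative g (at (L x)) (L v))) (at x)"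
    if "L x \<in> U" for x
  proof (rule has_derivative_compose[OF bounded_linear_imp_has_derivative[OF L]])
    show "(g has_derivative frechet_derivative g (at (L x))) (at (L x))"
      using Suc.prems that by (simp add: frechet_derivative_works[symmetric])
  qed
  have "C_k_on k (L -` U) (\<lambda>x. frechet_derivative (\<lambda>x. g (L x)) (at x) v)" for v
  proof (rule C_k_on_cong[OF \<open>open (L -` U)\<close>])
    show "C_k_on k (L -` U) (\<lambda>x. frechet_derivative g (at (L x)) (L v))"
      using Suc.prems by (intro Suc.IH) simp
    show "frechet_derivative g (at (L x)) (L v) = frechet_derivative (\<lambda>x. g (L x)) (at x) v"
      if "x \<in> L -` U" for x
      using frechet_derivative_at[OF der[of x]] that by (auto simp: fun_eq_iff)
  qed
  then show ?case using der by (auto simp: differentiable_def)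
qed

lemma smooth_on_sub_linear_compose:
  fixes L :: "'a::euclidean_space \<Rightarrow> 'b::euclidean_space"
  assumes L: "bounded_linear L" and f: "smooth_on_sub M f" and N: "L ` N \<subseteq> M"
    and h: "\<And>x. x \<in> N \<Longrightarrow> h x = f (L x)"
  shows "smooth_on_sub N h"
  unfolding smooth_on_sub_def
proof
  fix p assume "p \<in> N"
  then have "L p \<in> M" using N by blast
  with f obtain U g where U: "open U" "L p \<in> U" "\<forall>k. C_k_on k U g" "\<forall>x\<in>U \<inter> M. g x = f x"
    unfolding smooth_on_sub_def by meson
  have "open (L -` U)"
    using U(1) by (rule open_vimage) (rule linear_continuous_on[OF L])
  moreover have "\<forall>k. C_k_on k (L -` U) (\<lambda>x. g (L x))"
    using U C_k_on_linear_compose[OF L U(1)] by blast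
  moreover have "\<forall>x\<in>L -` U \<inter> N. g (L x) = h x" using U N h by auto
  ultimately show "\<exists>U g. open U \<and> p \<in> U \<and> (\<forall>k. C_k_on k U g) \<and> (\<forall>x\<in>U \<inter> N. g x = h x)"
    using U(2) by (intro exI[of _ "L -` U"] exI[of _ "\<lambda>x. g (L x)"] conjI) simp_all
qed

text \<open>By linearity the difference has zero Funk transform; its real and imaginary parts vanish
  on the sphere, and extensionality settles the values elsewhere.\<close>

lemma inj_on_Funk:
  assumes d: "DIM('a::euclidean_space) \<ge> 2"
  shows "inj_on Funk (even_smooth_sphere :: ('a \<Rightarrow> complex) set)"
proof (rule inj_onI)
  fix \<psi> \<eta> :: "'a \<Rightarrow> complex"
  assume psi: "\<psi> \<in> even_smooth_sphere" and eta: "\<eta> \<in> even_smooth_sphere" and eq: "Funk \<psi> = Funk \<eta>"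
  define f where "f x = \<psi> x - \<eta> x" for x
  have cont: "continuous_on unit_sphere \<psi>" "continuous_on unit_sphere \<eta>"
    using psi eta by (auto simp: even_smooth_sphere_def intro: smooth_on_sub_continuous)
  then have cf: "continuous_on unit_sphere f" unfolding f_def by (intro continuous_intros)
  have even: "f (- x) = f x" if "norm x = 1" for x
    using psi eta that by (simp add: even_smooth_sphere_def f_def)
  have zero: "(LINT \<theta>|subsphere_measure \<omega>. f \<theta>) = 0" if w: "norm \<omega> = 1" for \<omega>
  proof -
    have "(LINT \<theta>|subsphere_measure \<omega>. \<psi> \<theta>) = (LINT \<theta>|subsphere_measure \<omega>. \<eta> \<theta>)"
      using fun_cong[OF eq, of \<omega>] w by (simp add: Funk_def)
    then show ?thesis
      unfolding f_def using integrable_subsphere_continuous[OF d w] cont by simp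
  qed
  have "f e = 0" if e: "norm e = 1" for e
  proof (rule complex_eqI)
    show "Re (f e) = Re 0" unfolding zero_complex.sel
    proof (rule Funk_zero_imp_zero_real[OF d, where f = "\<lambda>x. Re (f x)"])
      show "(LINT \<theta>|subsphere_measure \<omega>. Re (f \<theta>)) = 0" if "norm \<omega> = 1" for \<omega>
        using integral_Re[OF integrable_subsphere_continuous[OF d that cf]] zero[OF that] by simp
    qed (use cf even e in \<open>auto intro!: continuous_intros\<close>)
    show "Im (f e) = Im 0" unfolding zero_complex.sel
    proof (rule Funk_zero_imp_zero_real[OF d, where f = "\<lambda>x. Im (f x)"])
      show "(LINT \<theta>|subsphere_measure \<omega>. Im (f \<theta>)) = 0" if "norm \<omega> = 1" for \<omega>
        using integral_Im[OF integrable_subsphere_continuous[OF d that cf]] zero[OF that] by simp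
    qed (use cf even e in \<open>auto intro!: continuous_intros\<close>)
  qed
  then have "\<psi> x = \<eta> x" if "x \<in> unit_sphere" for x using that by (simp add: f_def)
  then show "\<psi> = \<eta>"
    using psi eta by (intro extensionalityI[of _ unit_sphere]) (auto simp: even_smooth_sphere_def)
qed

text \<open>The first conjunct places the argument in the range of \<open>Funk\<close>, so that
  \<open>Funk_inv\<close>, a definite description, is a genuine inverse there.\<close>

theorem theorem4p17:
  fixes \<phi> :: "(real ^ 'n) \<times> real \<Rightarrow> complex"
    and f :: "real ^ 'n \<Rightarrow> real ^ 'n \<Rightarrow> complex"
  assumes n: "CARD('n) \<ge> 3"
    and smooth: "smooth_on_sub (unit_sphere \<times> UNIV) \<phi>"
    and even: "\<forall>\<theta>\<in>unit_sphere. \<forall>t. \<phi> (\<theta>, t) = \<phi> (- \<theta>, - t)"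
    and f: "\<forall>\<omega>\<in>unit_sphere. \<forall>u\<in>perp \<omega>. f \<omega> u = dual_Radon \<phi> \<omega> u"
  shows "(\<forall>x. (\<lambda>\<omega>\<in>unit_sphere. f \<omega> (proj_perp \<omega> x)) \<in> Funk ` even_smooth_sphere) \<and>
    (\<forall>\<theta>\<in>unit_sphere. \<forall>t.
       \<phi> (\<theta>, t) = Funk_inv (\<lambda>\<omega>\<in>unit_sphere. f \<omega> (proj_perp \<omega> (t *\<^sub>R \<theta>))) \<theta>)"
proof -
  have d: "DIM(real ^ 'n) \<ge> 2" using n by simp
  define \<psi> where "\<psi> x = (\<lambda>\<theta>\<in>unit_sphere. \<phi> (\<theta>, \<theta> \<bullet> x))" for x
  have psi: "\<psi> x \<in> even_smooth_sphere" for x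
  proof -
    \<comment> \<open>For fixed \<open>x\<close> the map from \<open>\<theta>\<close> to
      \<open>(\<theta>, \<theta> \<bullet> x)\<close> is linear, so smoothness is inherited from
      \<open>\<phi>\<close>.\<close>
    have "smooth_on_sub unit_sphere (\<psi> x)"
      by (rule smooth_on_sub_linear_compose[OF _ smooth, where L = "\<lambda>\<theta>. (\<theta>, \<theta> \<bullet> x)"])
         (auto simp: \<psi>_def intro!: bounded_linear_Pair bounded_linear_ident bounded_linear_inner_left)
    moreover have "\<psi> x (- \<theta>) = \<psi> x \<theta>" if "\<theta> \<in> unit_sphere" for \<theta>
      using bspec[OF even that, THEN spec, of "\<theta> \<bullet> x"] that by (simp add: \<psi>_def)
    ultimately show ?thesis by (auto simp: even_smooth_sphere_def \<psi>_def)
  qed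
  have Funk: "(\<lambda>\<omega>\<in>unit_sphere. f \<omega> (proj_perp \<omega> x)) = Funk (\<psi> x)" for x
    unfolding Funk_def
  proof (rule restrict_ext)
    fix \<omega> :: "real ^ 'n" assume w: "\<omega> \<in> unit_sphere"
    then have "norm \<omega> = 1" by simp
    have "f \<omega> (proj_perp \<omega> x) = (LINT \<theta>|subsphere_measure \<omega>. \<phi> (\<theta>, \<theta> \<bullet> proj_perp \<omega> x))"
      using bspec[OF bspec[OF f w] proj_perp_in_perp, of x] by (simp add: dual_Radon_def)
    \<comment> \<open>On the domain of integration \<open>\<theta>\<close> is orthogonal to
      \<open>\<omega>\<close>, so the projection drops out of the inner product.\<close>
    also have "\<dots> = (LINT \<theta>|subsphere_measure \<omega>. \<psi> x \<theta>)"
      by (intro Bochner_Integration.integral_cong refl)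
         (auto simp: space_subsphere_measure[OF d \<open>norm \<omega> = 1\<close>] \<psi>_def inner_proj_perp)
    finally show "f \<omega> (proj_perp \<omega> x) = (LINT \<theta>|subsphere_measure \<omega>. \<psi> x \<theta>)" .
  qed
  have "Funk_inv (Funk (\<psi> x)) = \<psi> x" for x
    unfolding Funk_inv_def using inj_on_Funk[OF d] psi by (rule the_inv_into_f_f)
  \<comment> \<open>At \<open>x = t *\<^sub>R \<theta>\<close> the second argument
    \<open>\<theta> \<bullet> x\<close> equals \<open>t\<close>, because \<open>\<theta>\<close> is
    a unit vector.\<close>
  moreover have "\<psi> (t *\<^sub>R \<theta>) \<theta> = \<phi> (\<theta>, t)" if "\<theta> \<in> unit_sphere" for \<theta> t
    using that by (simp add: \<psi>_def norm_eq_1)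
  ultimately show ?thesis unfolding Funk using psi by simp
qed

end
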